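(* Both $\mathbf{M}^+\mathbf{GrzB}$ and $\mathbf{MGLB}$ have the finite model property; that is, for $\mathbf{M}$ either of these two logics, every $\mathcal{L}_{\Diamond\exists}$-formula $\varphi\notin\mathbf{M}$ is refuted in some finite $\mathbf{M}$-frame.
   Context: $\mathcal{L}_{\Diamond\exists}$ is the propositional language with two modalities $\Diamond,\exists$, with $\Box=\neg\Diamond\neg$ and $\forall=\neg\exists\neg$. $\mathbf{GL}=\mathbf{K}+\Box(\Box p\to p)\to\Box p$ and $\mathbf{Grz}=\mathbf{K}+\Box(\Box(p\to\Box p)\to p)\to p$ (in modality $\Diamond$), and $\mathbf{S5}$ is formulated in modality $\exists$. For a unimodal logic $\mathbf{L}$, the fusion $\mathbf{L}\otimes\mathbf{S5}$ is the least set of $\mathcal{L}_{\Diamond\exists}$-formulae containing the theorems of $\mathbf{L}$ and of $\mathbf{S5}$ and closed under Modus Ponens, Substitution, $\Box$-necessitation, and $\forall$-necessitation; "$+$" denotes the least extension containing the given formulae and closed under the same rules. Put $$\mathbf{MLB}=(\mathbf{L}\otimes\mathbf{S5})+(\exists\Diamond p\to\Diamond\exists p)+(\Diamond\exists p\to\exists\Diamond p)$$ (giving $\mathbf{MGLB}$ and $\mathbf{MGrzB}$), and $$\mathbf{M}^+\mathbf{GrzB}=\mathbf{MGrzB}+\Box\forall(\Box(\Box p\to\Box\forall p)\to\Box\forall p)\to\Box\forall p.$$ A 2-frame is $(X,R,E)$ with $R$ a binary relation (interpreting $\Diamond$) and $E$ an equivalence relation (interpreting $\exists$) on $X$. For a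 logic $\mathbf{M}$, an $\mathbf{M}$-frame is a 2-frame validating all formulae of $\mathbf{M}$. A formula is refuted in a frame if it is false at some point under some valuation. *)

theory Defs
  imports Main
begin

datatype ufm = UVar nat | UBot | UImp ufm ufm | UDia ufm

abbreviation UNeg :: "ufm \<Rightarrow> ufm" where "UNeg a \<equiv> UImp a UBot"
abbreviation UBox :: "ufm \<Rightarrow> ufm" where "UBox a \<equiv> UNeg (UDia (UNeg a))"

primrec usubst :: "(nat \<Rightarrow> ufm) \<Rightarrow> ufm \<Rightarrow> ufm" where
  "usubst s (UVar n) = s n"
| "usubst s UBot = UBot"
| "usubst s (UImp a b) = UImp (usubst s a) (usubst s b)"
| "usubst s (UDia a) = UDia (usubst s a)"

text \<open>Boolean evaluation: variables and formulae \<open>UDia a\<close> are treated as atoms, so that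
  \<open>utaut\<close> consists of the substitution instances of classical propositional tautologies.\<close>

primrec ueval :: "(ufm \<Rightarrow> bool) \<Rightarrow> ufm \<Rightarrow> bool" where
  "ueval v (UVar n) = v (UVar n)"
| "ueval v UBot = False"
| "ueval v (UImp a b) = (ueval v a \<longrightarrow> ueval v b)"
| "ueval v (UDia a) = v (UDia a)"

definition utaut :: "ufm \<Rightarrow> bool" where
  "utaut a \<longleftrightarrow> (\<forall>v. ueval v a)"

text \<open>
  \<open>Kplus A\<close> is the least normal unimodal logic containing \<open>A\<close>. Since the diamond is
  primitive and the box is its defined dual, the usual duality axiom is not an instance of a
  tautology and has to be postulated: otherwise replacement of \<open>p\<close> by \<open>\<not>\<not>p\<close> under the diamond
  would not be derivable.
\<close>

inductive_set Kplus :: "ufm set \<Rightarrow> ufm set" for A :: "ufm set" where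
  taut: "utaut a \<Longrightarrow> a \<in> Kplus A"
| K: "UImp (UBox (UImp (UVar 0) (UVar 1))) (UImp (UBox (UVar 0)) (UBox (UVar 1))) \<in> Kplus A"
| dual1: "UImp (UDia (UVar 0)) (UNeg (UBox (UNeg (UVar 0)))) \<in> Kplus A"
| dual2: "UImp (UNeg (UBox (UNeg (UVar 0)))) (UDia (UVar 0)) \<in> Kplus A"
| ax: "a \<in> A \<Longrightarrow> a \<in> Kplus A"
| MP: "UImp a b \<in> Kplus A \<Longrightarrow> a \<in> Kplus A \<Longrightarrow> b \<in> Kplus A"
| subst: "a \<in> Kplus A \<Longrightarrow> usubst s a \<in> Kplus A"
| nec: "a \<in> Kplus A \<Longrightarrow> UBox a \<in> Kplus A"

definition GL :: "ufm set" where
  "GL = (let p = UVar 0 in Kplus {UImp (UBox (UImp (UBox p) p)) (UBox p)})"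

definition Grz :: "ufm set" where
  "Grz = (let p = UVar 0 in Kplus {UImp (UBox (UImp (UBox (UImp p (UBox p))) p)) p})"

definition S5 :: "ufm set" where
  "S5 = (let p = UVar 0 in
     Kplus {UImp (UBox p) p, UImp (UBox p) (UBox (UBox p)), UImp p (UBox (UDia p))})"

datatype fm = Var nat | Bot | Imp fm fm | Dia fm | Ex fm

abbreviation Neg :: "fm \<Rightarrow> fm" where "Neg a \<equiv> Imp a Bot"
abbreviation Box :: "fm \<Rightarrow> fm" where "Box a \<equiv> Neg (Dia (Neg a))"
abbreviation All :: "fm \<Rightarrow> fm" where "All a \<equiv> Neg (Ex (Neg a))"

primrec subst :: "(nat \<Rightarrow> fm) \<Rightarrow> fm \<Rightarrow> fm" where
  "subst s (Var n) = s n"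
| "subst s Bot = Bot"
| "subst s (Imp a b) = Imp (subst s a) (subst s b)"
| "subst s (Dia a) = Dia (subst s a)"
| "subst s (Ex a) = Ex (subst s a)"

primrec in_Dia :: "ufm \<Rightarrow> fm" where
  "in_Dia (UVar n) = Var n"
| "in_Dia UBot = Bot"
| "in_Dia (UImp a b) = Imp (in_Dia a) (in_Dia b)"
| "in_Dia (UDia a) = Dia (in_Dia a)"

primrec in_Ex :: "ufm \<Rightarrow> fm" where
  "in_Ex (UVar n) = Var n"
| "in_Ex UBot = Bot"
| "in_Ex (UImp a b) = Imp (in_Ex a) (in_Ex b)"
| "in_Ex (UDia a) = Ex (in_Ex a)"

inductive_set closure :: "fm set \<Rightarrow> fm set" for A :: "fm set" where
  base: "a \<in> A \<Longrightarrow> a \<in> closure A"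
| MP: "Imp a b \<in> closure A \<Longrightarrow> a \<in> closure A \<Longrightarrow> b \<in> closure A"
| subst: "a \<in> closure A \<Longrightarrow> subst s a \<in> closure A"
| nec_Box: "a \<in> closure A \<Longrightarrow> Box a \<in> closure A"
| nec_All: "a \<in> closure A \<Longrightarrow> All a \<in> closure A"

definition fusion :: "ufm set \<Rightarrow> ufm set \<Rightarrow> fm set" where
  "fusion L1 L2 = closure (in_Dia ` L1 \<union> in_Ex ` L2)"

definition extend :: "fm set \<Rightarrow> fm set \<Rightarrow> fm set" where
  "extend M A = closure (M \<union> A)"

definition MB :: "ufm set \<Rightarrow> fm set" where
  "MB L = (let p = Var 0 in
     extend (fusion L S5) {Imp (Ex (Dia p)) (Dia (Ex p)), Imp (Dia (Ex p)) (Ex (Dia p))})"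

definition MGLB :: "fm set" where
  "MGLB = MB GL"

definition MGrzB :: "fm set" where
  "MGrzB = MB Grz"

definition MplusGrzB :: "fm set" where
  "MplusGrzB = (let p = Var 0 in
     extend MGrzB
       {Imp (Box (All (Imp (Box (Imp (Box p) (Box (All p)))) (Box (All p))))) (Box (All p))})"

definition two_frame :: "'a set \<Rightarrow> 'a rel \<Rightarrow> 'a rel \<Rightarrow> bool" where
  "two_frame X R E \<longleftrightarrow> R \<subseteq> X \<times> X \<and> equiv X E"

primrec sat :: "'a rel \<Rightarrow> 'a rel \<Rightarrow> (nat \<Rightarrow> 'a set) \<Rightarrow> 'a \<Rightarrow> fm \<Rightarrow> bool" where
  "sat R E V x (Var n) \<longleftrightarrow> x \<in> V n"
| "sat R E V x Bot \<longleftrightarrow> False"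
| "sat R E V x (Imp a b) \<longleftrightarrow> (sat R E V x a \<longrightarrow> sat R E V x b)"
| "sat R E V x (Dia a) \<longleftrightarrow> (\<exists>y. (x, y) \<in> R \<and> sat R E V y a)"
| "sat R E V x (Ex a) \<longleftrightarrow> (\<exists>y. (x, y) \<in> E \<and> sat R E V y a)"

definition refuted :: "'a set \<Rightarrow> 'a rel \<Rightarrow> 'a rel \<Rightarrow> fm \<Rightarrow> bool" where
  "refuted X R E a \<longleftrightarrow> (\<exists>V. (\<forall>n. V n \<subseteq> X) \<and> (\<exists>x\<in>X. \<not> sat R E V x a))"

definition valid :: "'a set \<Rightarrow> 'a rel \<Rightarrow> 'a rel \<Rightarrow> fm \<Rightarrow> bool" where
  "valid X R E a \<longleftrightarrow> (\<forall>V. (\<forall>n. V n \<subseteq> X) \<longrightarrow> (\<forall>x\<in>X. sat R E V x a))"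

definition logic_frame :: "fm set \<Rightarrow> 'a set \<Rightarrow> 'a rel \<Rightarrow> 'a rel \<Rightarrow> bool" where
  "logic_frame M X R E \<longleftrightarrow> two_frame X R E \<and> (\<forall>a\<in>M. valid X R E a)"

text \<open>No generality is lost by taking natural numbers as points: every finite 2-frame is
  isomorphic to such a frame.\<close>

definition fmp :: "fm set \<Rightarrow> bool" where
  "fmp M \<longleftrightarrow>
     (\<forall>a. a \<notin> M \<longrightarrow>
       (\<exists>(X :: nat set) R E. finite X \<and> logic_frame M X R E \<and> refuted X R E a))"

end

theory Submission
  imports Defs
begin

text \<open>
  The canonical model of either logic has a transitive \<open>R\<close> and an equivalence \<open>E\<close>, and the two
  commutation axioms hold in it for all formulae, so they hold for all definable properties of
  points. Fix a finite subformula-closed set \<open>\<Sigma>\<close>, let \<open>ty x\<close> be the set of members of \<open>\<Sigma>\<close> true at \<open>x\<close>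
  and \<open>cty x\<close> the set of types occurring in the \<open>E\<close>-class of \<open>x\<close>; both are definable. The finite
  frame consists of the triples \<open>(cty x, fut x, t)\<close> with \<open>t \<in> cty x\<close>, where \<open>fut x\<close> collects the
  class types reachable from \<open>x\<close> at points from which \<open>cty x\<close> never recurs. A triple lies below
  another if the class type of the latter belongs to the \<open>fut\<close> component of the former and the
  \<open>fut\<close> components shrink, which makes the order strict; asking in addition that each type in either
  class be related to some type in the other makes it commute with the equivalence.

  Diamonds survive in this quotient once each class type is represented by a class all of whose
  diamonds have witnesses that leave the class type for good. For GL an \<open>R\<close>-last class of the given
  class type will do. For Grz the Barcan--Casari axiom provides, for each type \<open>t\<close> in the class, a
  strongly maximal point, every successor of which either repeats \<open>t\<close> and the class type or has left
  the class type for good; these are collected into a single class one type at a time.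
\<close>

section \<open>Soundness\<close>

text \<open>\<open>valid\<close> admits only valuations inside \<open>X\<close>, so the extensions
  of the substituted formulae are cut down to \<open>X\<close>. As \<open>R\<close> and
  \<open>E\<close> never leave \<open>X\<close>, evaluation from a point of \<open>X\<close> does
  not notice the cut.\<close>

lemma sat_subst:
  assumes "two_frame X R E" "x \<in> X"
  shows "sat R E V x (subst s a) \<longleftrightarrow> sat R E (\<lambda>n. {y \<in> X. sat R E V y (s n)}) x a"
proof -
  have "R \<subseteq> X \<times> X" "E \<subseteq> X \<times> X"
    using assms(1) by (auto simp: two_frame_def equiv_def refl_on_def)
  then show ?thesis
    using assms(2)
  proof (induction a arbitrary: x)
    case (Dia a)
    from Dia.IH[OF Dia.prems(1,2)] Dia.prems show ?case by (simp, blast)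
  next
    case (Ex a)
    from Ex.IH[OF Ex.prems(1,2)] Ex.prems show ?case by (simp, blast)
  qed auto
qed

lemma valid_closure:
  assumes "a \<in> closure A" "two_frame X R E" "\<And>a. a \<in> A \<Longrightarrow> valid X R E a"
  shows "valid X R E a"
  using assms(1)
proof induction
  case (subst a s)
  then show ?case using sat_subst[OF assms(2)] by (auto simp: valid_def)
next
  case (nec_Box a)
  then show ?case using assms(2) by (auto simp: valid_def two_frame_def)
next
  case (nec_All a)
  have "E \<subseteq> X \<times> X" using assms(2) by (simp add: two_frame_def equiv_def refl_on_def)
  with nec_All show ?case by (auto simp: valid_def)
next
  case (MP a b)
  then show ?case by (auto simp: valid_def)
qed (use assms(3) in auto)

text \<open>The two embeddings differ only in the target modality \<open>D\<close>, so soundness and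
  normality are proved once for both.\<close>

locale translation =
  fixes f :: "ufm \<Rightarrow> fm" and D :: "fm \<Rightarrow> fm"
  assumes f_simps [simp]: "f (UVar n) = Var n" "f UBot = Bot"
      "f (UImp a b) = Imp (f a) (f b)" "f (UDia a) = D (f a)"
    and subst_D [simp]: "subst s (D c) = D (subst s c)"
begin

lemma f_usubst: "f (usubst s a) = subst (\<lambda>n. f (s n)) (f a)"
  by (induction a) auto

text \<open>Satisfaction at a point is a Boolean valuation of variables and translated diamonds,
  which makes tautologies true everywhere.\<close>

lemma sat_ueval: "sat R E V x (f a) \<longleftrightarrow> ueval (\<lambda>u. sat R E V x (f u)) a"
  by (induction a) (simp_all only: f_simps ueval.simps sat.simps)

lemma valid_Kplus:
  assumes "a \<in> Kplus A" "two_frame X R E" "S \<subseteq> X \<times> X"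
    and sat_D: "\<And>V x a. sat R E V x (D a) \<longleftrightarrow> (\<exists>y. (x, y) \<in> S \<and> sat R E V y a)"
    and "\<And>a. a \<in> A \<Longrightarrow> valid X R E (f a)"
  shows "valid X R E (f a)"
  using assms(1)
proof induction
  case (taut a)
  then show ?case by (simp add: valid_def utaut_def sat_ueval[where a = a])
next
  case (subst a s)
  then show ?case using sat_subst[OF assms(2)] by (auto simp: valid_def f_usubst)
next
  case (nec a)
  then show ?case using assms(3) by (auto simp: valid_def sat_D)
next
  case (MP a b)
  then show ?case by (auto simp: valid_def)
qed (use assms(5) in \<open>auto simp: valid_def sat_D\<close>)

end

interpretation dia: translation in_Dia Dia
  by standard auto

interpretation ex: translation in_Ex Ex
  by standard auto

text \<open>The two inclusions in \<open>E O R = R O E\<close> are the frame conditions behind the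
  two commutation axioms. The unimodal axioms \<open>A\<close> stay a parameter, to be filled by GL
  or Grz.\<close>

lemma logic_frame_MB:
  assumes "two_frame X R E" "E O R = R O E"
    and "\<And>a. a \<in> A \<Longrightarrow> valid X R E (in_Dia a)" "a \<in> MB (Kplus A)"
  shows "valid X R E a"
proof -
  have E: "E \<subseteq> X \<times> X" "equiv X E" and R: "R \<subseteq> X \<times> X"
    using assms(1) by (auto simp: two_frame_def equiv_def refl_on_def)
  have "valid X R E (in_Dia b)" if "b \<in> Kplus A" for b
    using dia.valid_Kplus[OF that assms(1) R _ assms(3)] by auto
  moreover have "valid X R E (in_Ex b)" if "b \<in> S5" for b
  proof (rule ex.valid_Kplus[OF that[unfolded S5_def Let_def] assms(1) E(1)])
    have "refl_on X E" "sym E" "trans E"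
      using E(2) by (auto simp: equiv_def)
    then show "valid X R E (in_Ex a)"
      if "a \<in> {UImp (UBox (UVar 0)) (UVar 0), UImp (UBox (UVar 0)) (UBox (UBox (UVar 0))),
        UImp (UVar 0) (UBox (UDia (UVar 0)))}" for a
      using that by (auto simp: valid_def dest: refl_onD) (meson symD transD)+
  qed simp
  ultimately have fus: "valid X R E b" if "b \<in> fusion (Kplus A) S5" for b
    using valid_closure[OF that[unfolded fusion_def] assms(1)] by auto
  have ER: "\<exists>y. (x, y) \<in> R \<and> (y, z) \<in> E" if "(x, y) \<in> E" "(y, z) \<in> R" for x y z
    using assms(2) that by blast
  have RE: "\<exists>y. (x, y) \<in> E \<and> (y, z) \<in> R" if "(x, y) \<in> R" "(y, z) \<in> E" for x y z
    using assms(2) that by blast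
  have "valid X R E (Imp (Ex (Dia (Var 0))) (Dia (Ex (Var 0))))"
    "valid X R E (Imp (Dia (Ex (Var 0))) (Ex (Dia (Var 0))))"
    by (auto simp: valid_def) (meson ER RE)+
  then show ?thesis
    using fus valid_closure[OF assms(4)[unfolded MB_def Let_def extend_def] assms(1)] by auto
qed

section \<open>Finite strict orders commuting with an equivalence\<close>

locale strict_frame =
  fixes X :: "'a set" and S E :: "'a rel"
  assumes finite_X: "finite X" and S_sub: "S \<subseteq> X \<times> X" and trans_S: "trans S"
    and irrefl_S: "irrefl S" and equiv_E: "equiv X E" and commute: "E O S = S O E"
begin

text \<open>The arguments for GL, Grz and the Casari axiom are all inductions along this relation: a
  point is treated after everything strictly above it.\<close>

lemma wf_S: "wf (S\<inverse>)"
proof -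
  have "acyclic S"
    using trans_S irrefl_S by (simp add: acyclic_def irrefl_def)
  moreover have "finite S"
    using S_sub finite_X by (meson finite_SigmaI finite_subset)
  ultimately show ?thesis by (rule finite_acyclic_wf_converse[rotated])
qed

lemma logic_frame_MGLB: "logic_frame MGLB X S E"
proof -
  have fr: "two_frame X S E"
    using S_sub equiv_E by (simp add: two_frame_def)
  have GL: "valid X S E (Imp (Box (Imp (Box (Var 0)) (Var 0))) (Box (Var 0)))"
    unfolding valid_def
  proof (intro allI impI ballI)
    fix V :: "nat \<Rightarrow> 'a set" and x
    have "(\<forall>y. (x, y) \<in> S \<longrightarrow> (\<forall>z. (y, z) \<in> S \<longrightarrow> z \<in> V 0) \<longrightarrow> y \<in> V 0) \<longrightarrow>
        (\<forall>y. (x, y) \<in> S \<longrightarrow> y \<in> V 0)" (is ?P)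
    proof (intro impI allI)
      fix y assume *: "\<forall>y. (x, y) \<in> S \<longrightarrow> (\<forall>z. (y, z) \<in> S \<longrightarrow> z \<in> V 0) \<longrightarrow> y \<in> V 0"
        and "(x, y) \<in> S"
      from wf_S this(2) show "y \<in> V 0"
      proof (induction y)
        case (less y)
        have "z \<in> V 0" if "(y, z) \<in> S" for z
          using less.IH[of z] that transD[OF trans_S less.prems that] by simp
        then show ?case using * less.prems by blast
      qed
    qed
    moreover have "sat S E V x (Imp (Box (Imp (Box (Var 0)) (Var 0))) (Box (Var 0))) \<longleftrightarrow> ?P"
      by (simp only: sat.simps simp_thms not_ex not_all not_imp de_Morgan_conj de_Morgan_disj
          imp_conv_disj conj_ac disj_ac)
    ultimately show "sat S E V x (Imp (Box (Imp (Box (Var 0)) (Var 0))) (Box (Var 0)))" by blast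
  qed
  have "valid X S E a" if "a \<in> MGLB" for a
    by (rule logic_frame_MB[OF fr commute _ that[unfolded MGLB_def GL_def Let_def]])
      (simp only: singleton_iff in_Dia.simps GL)
  then show ?thesis
    using fr by (simp add: logic_frame_def)
qed

text \<open>One strict order serves both logics: GL reads \<open>S\<close> itself, Grz its reflexive
  closure, and commutation survives since the identity on \<open>X\<close> commutes with
  \<open>E\<close>.\<close>

lemma logic_frame_MplusGrzB: "logic_frame MplusGrzB X (S \<union> Id_on X) E"
proof -
  let ?R = "S \<union> Id_on X"
  have fr: "two_frame X ?R E"
    using S_sub equiv_E by (auto simp: two_frame_def)
  have E: "E \<subseteq> X \<times> X" "sym E" "trans E" and refl_E: "\<And>x. x \<in> X \<Longrightarrow> (x, x) \<in> E"
    using equiv_E by (auto simp: equiv_def refl_on_def)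
  have comm: "E O ?R = ?R O E"
    using commute E(1) by blast
  have Grz: "valid X ?R E (Imp (Box (Imp (Box (Imp (Var 0) (Box (Var 0)))) (Var 0))) (Var 0))"
    unfolding valid_def
  proof (intro allI impI ballI)
    fix V :: "nat \<Rightarrow> 'a set" and x assume "x \<in> X"
    have "(\<forall>y. (x, y) \<in> ?R \<longrightarrow>
        (\<forall>z. (y, z) \<in> ?R \<longrightarrow> z \<in> V 0 \<longrightarrow> (\<forall>u. (z, u) \<in> ?R \<longrightarrow> u \<in> V 0)) \<longrightarrow> y \<in> V 0) \<longrightarrow>
        x \<in> V 0" (is ?P)
    proof
      assume *: "\<forall>y. (x, y) \<in> ?R \<longrightarrow>
        (\<forall>z. (y, z) \<in> ?R \<longrightarrow> z \<in> V 0 \<longrightarrow> (\<forall>u. (z, u) \<in> ?R \<longrightarrow> u \<in> V 0)) \<longrightarrow> y \<in> V 0"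
      have "y \<in> V 0" if "(x, y) \<in> ?R" for y
        using wf_S that
      proof (induction y)
        case (less y)
        \<comment> \<open>All points strictly above \<open>y\<close> lie in \<open>V 0\<close>. If
          \<open>y\<close> does not, every \<open>z\<close> in \<open>V 0\<close> seen from
          \<open>y\<close> is strictly above it, so the antecedent of the inner implication of Grz
          holds at \<open>y\<close> and forces \<open>y\<close> into \<open>V 0\<close>.\<close>
        have up: "z \<in> V 0" if "(y, z) \<in> S" for z
          using less.IH[of z] less.prems that transD[OF trans_S _ that] by auto
        have "u \<in> V 0" if "y \<notin> V 0" "(y, z) \<in> ?R" "z \<in> V 0" "(z, u) \<in> ?R" for z u
          using that up[of z] up[of u] transD[OF trans_S, of y z u] by (cases "z = u") auto
        then show ?case using * less.prems by blast
      qed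
      then show "x \<in> V 0" using \<open>x \<in> X\<close> by blast
    qed
    moreover have "sat ?R E V x (Imp (Box (Imp (Box (Imp (Var 0) (Box (Var 0)))) (Var 0))) (Var 0)) \<longleftrightarrow> ?P"
      by (simp only: sat.simps simp_thms not_ex not_all not_imp de_Morgan_conj de_Morgan_disj
          imp_conv_disj conj_ac disj_ac)
    ultimately show "sat ?R E V x (Imp (Box (Imp (Box (Imp (Var 0) (Box (Var 0)))) (Var 0))) (Var 0))" by blast
  qed
  have MGrzB: "valid X ?R E a" if "a \<in> MGrzB" for a
    by (rule logic_frame_MB[OF fr comm _ that[unfolded MGrzB_def Grz_def Let_def]])
      (simp only: singleton_iff in_Dia.simps Grz)
  have "valid X ?R E (Imp (Box (All (Imp (Box (Imp (Box (Var 0)) (Box (All (Var 0))))) (Box (All (Var 0))))))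
      (Box (All (Var 0))))"
    unfolding valid_def
  proof (intro allI impI ballI)
    fix V :: "nat \<Rightarrow> 'a set" and x assume "x \<in> X"
    let ?B = "\<lambda>x. \<forall>y. (x, y) \<in> ?R \<longrightarrow> (\<forall>z. (y, z) \<in> E \<longrightarrow> z \<in> V 0)"
    let ?C = "\<lambda>z. \<forall>w. (z, w) \<in> ?R \<longrightarrow> (\<forall>u. (w, u) \<in> ?R \<longrightarrow> u \<in> V 0) \<longrightarrow> ?B w"
    have "(\<forall>y. (x, y) \<in> ?R \<longrightarrow> (\<forall>z. (y, z) \<in> E \<longrightarrow> ?C z \<longrightarrow> ?B z)) \<longrightarrow> ?B x" (is ?P)
    proof (intro impI allI)
      fix y z
      assume *: "\<forall>y. (x, y) \<in> ?R \<longrightarrow> (\<forall>z. (y, z) \<in> E \<longrightarrow> ?C z \<longrightarrow> ?B z)"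
        and "(x, y) \<in> ?R" "(y, z) \<in> E"
      from wf_S this(2,3) show "z \<in> V 0"
      proof (induction y arbitrary: z)
        case (less y)
        \<comment> \<open>Commutation turns a step out of the class of \<open>y\<close> into a step
          from \<open>y\<close> itself to some \<open>u\<close> in the class of \<open>w\<close>.
          The induction hypothesis at \<open>u\<close> then covers that whole class.\<close>
        have up: "v \<in> V 0" if zw: "(z, w) \<in> S" and wv: "(w, v) \<in> E" for w v
        proof -
          obtain u where u: "(y, u) \<in> S" "(u, w) \<in> E"
            using commute less.prems(2) zw by blast
          then have "(x, u) \<in> ?R"
            using less.prems(1) transD[OF trans_S, of x y u] by auto
          then show ?thesis
            using less.IH[of u v] u transD[OF E(3) u(2) wv] by simp
        qed
        have zX: "z \<in> X" using less.prems(2) E(1) by blast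
        have B_up: "?B w" if "(z, w) \<in> S" for w
          using up[of w] up that transD[OF trans_S that] by auto
        \<comment> \<open>A \<open>w\<close> at or above \<open>z\<close> all of whose successors
          lie in \<open>V 0\<close> lies there itself by reflexivity, so it differs from
          \<open>z\<close> and is strictly above it, where \<open>B_up\<close> applies. The premise
          of the axiom then yields \<open>?B z\<close>, hence \<open>z \<in> V 0\<close>.\<close>
        have "?C z" if "z \<notin> V 0"
        proof (intro allI impI)
          fix w t v
          assume w: "(z, w) \<in> ?R" "\<forall>u. (w, u) \<in> ?R \<longrightarrow> u \<in> V 0" and wv: "(w, t) \<in> ?R" "(t, v) \<in> E"
          then have "(z, w) \<in> S" using that zX by auto
          from B_up[OF this] wv show "v \<in> V 0" by blast
        qed
        moreover have "z \<in> V 0" if "?B z" using that zX refl_E[OF zX] by blast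
        ultimately show ?case using * less.prems by blast
      qed
    qed
    moreover have "sat ?R E V x (Imp (Box (All (Imp (Box (Imp (Box (Var 0)) (Box (All (Var 0))))) (Box (All (Var 0))))))
      (Box (All (Var 0)))) \<longleftrightarrow> ?P"
      by (simp only: sat.simps simp_thms not_ex not_all not_imp de_Morgan_conj de_Morgan_disj
          imp_conv_disj conj_ac disj_ac)
    ultimately show "sat ?R E V x (Imp (Box (All (Imp (Box (Imp (Box (Var 0)) (Box (All (Var 0))))) (Box (All (Var 0))))))
      (Box (All (Var 0))))" by blast
  qed
  then show ?thesis
    using fr valid_closure[OF _ fr] MGrzB
    by (auto simp: logic_frame_def MplusGrzB_def extend_def Let_def)
qed

end

section \<open>Transfer to frames on natural numbers\<close>

lemma refuted_iso:
  assumes g: "bij_betw g Y X" and "two_frame X R E"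
  defines "R' \<equiv> {(x, y) \<in> Y \<times> Y. (g x, g y) \<in> R}" and "E' \<equiv> {(x, y) \<in> Y \<times> Y. (g x, g y) \<in> E}"
  shows "refuted Y R' E' a \<longleftrightarrow> refuted X R E a"
proof -
  have RE: "R \<subseteq> X \<times> X" "E \<subseteq> X \<times> X"
    using assms(2) by (auto simp: two_frame_def equiv_def refl_on_def)
  have X_eq: "X = g ` Y" using g by (simp add: bij_betw_def)
  have surj: "\<exists>y\<in>Y. x = g y" if "x \<in> X" for x
    using g that by (auto simp: bij_betw_def)
  have gX: "g y \<in> X" if "y \<in> Y" for y
    using g that by (auto simp: bij_betw_def)
  have sat: "sat R' E' (\<lambda>n. {y \<in> Y. g y \<in> V n}) y a \<longleftrightarrow> sat R E V (g y) a" if "y \<in> Y" for V y a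
    using that
  proof (induction a arbitrary: y)
    case (Dia a)
    have "sat R' E' (\<lambda>n. {y \<in> Y. g y \<in> V n}) y (Dia a) \<longleftrightarrow> (\<exists>z\<in>Y. (g y, g z) \<in> R \<and> sat R E V (g z) a)"
      using Dia.IH Dia.prems by (auto simp: R'_def)
    also have "\<dots> \<longleftrightarrow> (\<exists>w\<in>g ` Y. (g y, w) \<in> R \<and> sat R E V w a)" by simp
    also have "\<dots> \<longleftrightarrow> sat R E V (g y) (Dia a)" using RE X_eq by auto
    finally show ?case .
  next
    case (Ex a)
    have "sat R' E' (\<lambda>n. {y \<in> Y. g y \<in> V n}) y (Ex a) \<longleftrightarrow> (\<exists>z\<in>Y. (g y, g z) \<in> E \<and> sat R E V (g z) a)"
      using Ex.IH Ex.prems by (auto simp: E'_def)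
    also have "\<dots> \<longleftrightarrow> (\<exists>w\<in>g ` Y. (g y, w) \<in> E \<and> sat R E V w a)" by simp
    also have "\<dots> \<longleftrightarrow> sat R E V (g y) (Ex a)" using RE X_eq by auto
    finally show ?case .
  qed auto
  show ?thesis
  proof
    assume "refuted Y R' E' a"
    then obtain V y where V: "\<And>n. V n \<subseteq> Y" "y \<in> Y" "\<not> sat R' E' V y a"
      by (auto simp: refuted_def)
    \<comment> \<open>Injectivity of \<open>g\<close> on \<open>Y\<close> makes preimage undo image,
      so a valuation on \<open>Y\<close> is the pullback of one on \<open>X\<close>.\<close>
    have "{y \<in> Y. g y \<in> g ` V n} = V n" for n
      using V(1)[of n] inj_on_image_mem_iff[OF bij_betw_imp_inj_on[OF g]] by blast
    then have V_eq: "(\<lambda>n. {y \<in> Y. g y \<in> g ` V n}) = V" ..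
    have "\<not> sat R E (\<lambda>n. g ` V n) (g y) a"
      using sat[OF V(2), of "\<lambda>n. g ` V n" a] V(3) unfolding V_eq by blast
    moreover have "g ` V n \<subseteq> X" for n using V(1)[of n] gX by blast
    ultimately show "refuted X R E a"
      using gX[OF V(2)] unfolding refuted_def by (intro exI[of _ "\<lambda>n. g ` V n"]) auto
  next
    assume "refuted X R E a"
    then obtain V x where V: "x \<in> X" "\<not> sat R E V x a"
      by (auto simp: refuted_def)
    obtain y where "y \<in> Y" "x = g y" using surj[OF V(1)] by blast
    then have "\<not> sat R' E' (\<lambda>n. {y \<in> Y. g y \<in> V n}) y a"
      using sat[of y V a] V(2) by simp
    with \<open>y \<in> Y\<close> show "refuted Y R' E' a"
      unfolding refuted_def by (intro exI[of _ "\<lambda>n. {y \<in> Y. g y \<in> V n}"]) auto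
  qed
qed

lemma valid_iff_not_refuted: "valid X R E a \<longleftrightarrow> \<not> refuted X R E a"
  by (auto simp: valid_def refuted_def)

text \<open>The finite frame may live on any type: enumerating its points gives an isomorphic copy
  on an initial segment of the naturals, and validity transfers as absence of refutation.\<close>

lemma fmpI:
  assumes "\<And>a. a \<notin> M \<Longrightarrow> \<exists>(X :: 'a set) R E. finite X \<and> logic_frame M X R E \<and> refuted X R E a"
  shows "fmp M"
  unfolding fmp_def
proof (intro allI impI)
  fix a assume "a \<notin> M"
  then obtain X :: "'a set" and R E where fin: "finite X" and lf: "logic_frame M X R E" and ref: "refuted X R E a"
    using assms by blast
  obtain g where g: "bij_betw g {0..<card X} X"
    using ex_bij_betw_nat_finite[OF fin] by blast
  let ?Y = "{0..<card X}"
  let ?R = "{(x, y) \<in> ?Y \<times> ?Y. (g x, g y) \<in> R}" and ?E = "{(x, y) \<in> ?Y \<times> ?Y. (g x, g y) \<in> E}"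
  have fr: "two_frame X R E" using lf by (simp add: logic_frame_def)
  have gX: "\<And>y. y \<in> ?Y \<Longrightarrow> g y \<in> X" using g by (auto simp: bij_betw_def)
  have E: "refl_on X E" "sym E" "trans E"
    using fr by (auto simp: two_frame_def equiv_def)
  have "equiv ?Y ?E"
  proof (rule equivI)
    show "sym ?E" using E(2) by (auto simp: sym_def)
    show "trans ?E" using E(3) by (auto simp: trans_def)
  qed (use E(1) gX in \<open>auto simp: refl_on_def\<close>)
  then have "two_frame ?Y ?R ?E" by (auto simp: two_frame_def)
  then have "logic_frame M ?Y ?R ?E \<and> refuted ?Y ?R ?E a"
    using lf ref refuted_iso[OF g fr] by (simp add: logic_frame_def valid_iff_not_refuted)
  then show "\<exists>(X :: nat set) R E. finite X \<and> logic_frame M X R E \<and> refuted X R E a"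
    by blast
qed

section \<open>Canonical models\<close>

text \<open>Necessitation and substitution are left to \<open>M\<close>, so they never touch
  hypotheses and the deduction theorem holds.\<close>

inductive derivable :: "fm set \<Rightarrow> fm set \<Rightarrow> fm \<Rightarrow> bool" for M G where
  logic: "a \<in> M \<Longrightarrow> derivable M G a"
| hyp: "a \<in> G \<Longrightarrow> derivable M G a"
| MP: "derivable M G (Imp a b) \<Longrightarrow> derivable M G a \<Longrightarrow> derivable M G b"

lemma derivable_mono: "derivable M G a \<Longrightarrow> G \<subseteq> H \<Longrightarrow> derivable M H a"
proof (induction rule: derivable.induct)
  case (MP a b)
  then show ?case using derivable.MP by blast
qed (auto intro: derivable.logic derivable.hyp)

lemma derivable_finite:
  assumes "derivable M G a"
  shows "\<exists>F \<subseteq> G. finite F \<and> derivable M F a"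
  using assms
proof induction
  case (logic a)
  then show ?case by (auto intro: derivable.logic)
next
  case (hyp a)
  then show ?case by (intro exI[of _ "{a}"]) (auto intro: derivable.hyp)
next
  case (MP a b)
  then obtain F1 F2 where F: "F1 \<subseteq> G" "finite F1" "derivable M F1 (Imp a b)"
    "F2 \<subseteq> G" "finite F2" "derivable M F2 a" by auto
  then have "derivable M (F1 \<union> F2) b"
    using derivable.MP[OF derivable_mono[OF F(3) sup_ge1] derivable_mono[OF F(6) sup_ge2]] by simp
  with F show ?case by (intro exI[of _ "F1 \<union> F2"]) auto
qed

definition mcs :: "fm set \<Rightarrow> fm set \<Rightarrow> bool" where
  "mcs M x \<longleftrightarrow> \<not> derivable M x Bot \<and> (\<forall>a. a \<notin> x \<longrightarrow> derivable M (insert a x) Bot)"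

text \<open>Zorn's lemma applies because a derivation of \<open>Bot\<close> from the union of a
  chain uses finitely many hypotheses, all in one member of the chain.\<close>

lemma Lindenbaum:
  assumes "\<not> derivable M G Bot"
  shows "\<exists>x. G \<subseteq> x \<and> mcs M x"
proof -
  let ?A = "{x. G \<subseteq> x \<and> \<not> derivable M x Bot}"
  have "\<exists>x\<in>?A. \<forall>y\<in>?A. x \<subseteq> y \<longrightarrow> y = x"
  proof (rule subset_Zorn_nonempty)
    show "?A \<noteq> {}" using assms by blast
    fix C assume C: "C \<noteq> {}" "subset.chain ?A C"
    have "\<not> derivable M (\<Union>C) Bot"
    proof
      assume "derivable M (\<Union>C) Bot"
      then obtain F where F: "F \<subseteq> \<Union>C" "finite F" "derivable M F Bot"
        using derivable_finite[of M "\<Union>C" Bot] by auto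
      obtain x where "x \<in> C" "F \<subseteq> x"
        using finite_subset_Union_chain[OF F(2,1) C] by blast
      then show False
        using derivable_mono[OF F(3)] C(2) by (auto simp: subset_chain_def)
    qed
    moreover have "G \<subseteq> \<Union>C"
    proof -
      obtain x where "x \<in> C" using C(1) by blast
      then show ?thesis using C(2) by (auto simp: subset_chain_def)
    qed
    ultimately show "\<Union>C \<in> ?A" by simp
  qed
  then obtain x where x: "x \<in> ?A" and max: "\<forall>y\<in>?A. x \<subseteq> y \<longrightarrow> y = x" ..
  have "derivable M (insert a x) Bot" if "a \<notin> x" for a
  proof (rule ccontr)
    assume "\<not> derivable M (insert a x) Bot"
    with x have "insert a x \<in> ?A" by auto
    with max have "insert a x = x" by (auto dest!: bspec)
    with that show False by blast
  qed
  with x show ?thesis by (auto simp: mcs_def)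
qed

text \<open>The two duality clauses make \<open>D\<close> interchangeable with \<open>\<lambda>a. Neg (B (Neg a))\<close>, where \<open>B\<close> is
  the box of \<open>D\<close>; double negations under \<open>D\<close> could not be removed without them.\<close>

definition normal_op :: "fm set \<Rightarrow> (fm \<Rightarrow> fm) \<Rightarrow> bool" where
  "normal_op M D \<longleftrightarrow>
    (\<forall>a\<in>M. Neg (D (Neg a)) \<in> M) \<and>
    (\<forall>a b. Imp (Neg (D (Neg (Imp a b)))) (Imp (Neg (D (Neg a))) (Neg (D (Neg b)))) \<in> M) \<and>
    (\<forall>a. Imp (D a) (Neg (Neg (D (Neg (Neg a))))) \<in> M) \<and>
    (\<forall>a. Imp (Neg (Neg (D (Neg (Neg a))))) (D a) \<in> M)"

text \<open>The three propositional schemes form a Hilbert basis for \<open>Imp\<close> and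
  \<open>Bot\<close>: the first two carry the deduction theorem, the third makes negation
  classical.\<close>

locale normal_logic =
  fixes M :: "fm set"
  assumes axK: "Imp a (Imp b a) \<in> M"
    and axS: "Imp (Imp a (Imp b c)) (Imp (Imp a b) (Imp a c)) \<in> M"
    and axDN: "Imp (Neg (Neg a)) a \<in> M"
    and MP_closed: "Imp a b \<in> M \<Longrightarrow> a \<in> M \<Longrightarrow> b \<in> M"
    and normal_Dia: "normal_op M Dia"
    and normal_Ex: "normal_op M Ex"
begin

lemma derivable_weaken: "derivable M G b \<Longrightarrow> derivable M G (Imp a b)"
  by (rule derivable.MP[OF derivable.logic[OF axK]])

lemma deduction:
  assumes "derivable M (insert a G) b"
  shows "derivable M G (Imp a b)"
  using assms
proof induction
  case (logic b)
  then show ?case by (intro derivable_weaken derivable.logic)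
next
  case (hyp b)
  have "derivable M G (Imp a a)"
    by (rule derivable.MP[OF derivable.MP[OF derivable.logic[OF axS] derivable.logic[OF axK]]
          derivable.logic[OF axK]])
  with hyp show ?case by (auto intro: derivable_weaken derivable.hyp)
next
  case (MP b c)
  show ?case by (rule derivable.MP[OF derivable.MP[OF derivable.logic[OF axS] MP.IH(1)] MP.IH(2)])
qed

lemma derivable_empty: "derivable M {} a \<Longrightarrow> a \<in> M"
proof (induction rule: derivable.induct)
  case (MP a b)
  then show ?case using MP_closed by blast
qed auto

context
  fixes x assumes x: "mcs M x"
begin

lemma mcs_closed:
  assumes "derivable M x a"
  shows "a \<in> x"
proof (rule ccontr)
  assume "a \<notin> x"
  then have "derivable M x (Neg a)" using x deduction by (auto simp: mcs_def)
  with assms show False using x derivable.MP by (auto simp: mcs_def)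
qed

lemma mcs_Bot: "Bot \<notin> x"
  using x derivable.hyp by (auto simp: mcs_def)

lemma mcs_logic: "a \<in> M \<Longrightarrow> a \<in> x"
  using mcs_closed derivable.logic by blast

lemma mcs_Imp: "Imp a b \<in> x \<longleftrightarrow> (a \<in> x \<longrightarrow> b \<in> x)"
proof
  assume "Imp a b \<in> x"
  then show "a \<in> x \<longrightarrow> b \<in> x" using mcs_closed derivable.MP derivable.hyp by blast
next
  assume ab: "a \<in> x \<longrightarrow> b \<in> x"
  show "Imp a b \<in> x"
  proof (cases "a \<in> x")
    case True
    then show ?thesis using ab mcs_closed derivable_weaken derivable.hyp by blast
  next
    case False
    then have "derivable M (insert a x) Bot" using x by (auto simp: mcs_def)
    then have "derivable M (insert a x) (Neg (Neg b))" by (rule derivable_weaken)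
    then have "derivable M (insert a x) b" by (rule derivable.MP[OF derivable.logic[OF axDN]])
    then show ?thesis using deduction mcs_closed by blast
  qed
qed

end

text \<open>The formulae whose box lies in \<open>x\<close> are closed under derivation, by
  necessitation and K. Were they inconsistent with \<open>a\<close>, the box of \<open>Neg a\<close>
  would be in \<open>x\<close>, against \<open>D a\<close>; so Lindenbaum's lemma extends them
  together with \<open>a\<close>.\<close>

lemma mcs_existence:
  assumes D: "normal_op M D" and x: "mcs M x" and "D a \<in> x"
  shows "\<exists>y. mcs M y \<and> a \<in> y \<and> (\<forall>b. Neg (D (Neg b)) \<in> x \<longrightarrow> b \<in> y)"
proof -
  let ?G = "{b. Neg (D (Neg b)) \<in> x}"
  have box: "Neg (D (Neg b)) \<in> x" if "derivable M ?G b" for b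
    using that
  proof induction
    case (logic b)
    then show ?case using D mcs_logic[OF x] by (auto simp: normal_op_def)
  next
    case (MP b c)
    have "Imp (Neg (D (Neg (Imp b c)))) (Imp (Neg (D (Neg b))) (Neg (D (Neg c)))) \<in> x"
      using D mcs_logic[OF x] unfolding normal_op_def by blast
    with MP.IH show ?case using mcs_Imp[OF x] by blast
  qed blast
  have "\<not> derivable M (insert a ?G) Bot"
  proof
    assume "derivable M (insert a ?G) Bot"
    then have "Neg (D (Neg (Neg a))) \<in> x" using box deduction by blast
    moreover have "Imp (D a) (Neg (Neg (D (Neg (Neg a))))) \<in> x"
      using D mcs_logic[OF x] unfolding normal_op_def by blast
    ultimately show False using \<open>D a \<in> x\<close> mcs_Imp[OF x] mcs_Bot[OF x] by blast
  qed
  from Lindenbaum[OF this] show ?thesis by blast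
qed

lemma mcs_diamond:
  assumes D: "normal_op M D" and x: "mcs M x"
  shows "D a \<in> x \<longleftrightarrow> (\<exists>y. mcs M y \<and> (\<forall>b. Neg (D (Neg b)) \<in> x \<longrightarrow> b \<in> y) \<and> a \<in> y)"
proof
  assume "\<exists>y. mcs M y \<and> (\<forall>b. Neg (D (Neg b)) \<in> x \<longrightarrow> b \<in> y) \<and> a \<in> y"
  then obtain y where y: "mcs M y" "\<And>b. Neg (D (Neg b)) \<in> x \<Longrightarrow> b \<in> y" "a \<in> y" by blast
  have "Imp (Neg (Neg (D (Neg (Neg a))))) (D a) \<in> x"
    using D mcs_logic[OF x] unfolding normal_op_def by blast
  moreover have "Neg a \<notin> y" using y mcs_Imp mcs_Bot by blast
  ultimately show "D a \<in> x" using y(2) mcs_Imp[OF x] mcs_Bot[OF x] by blast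
qed (use mcs_existence[OF D x] in blast)

end

text \<open>The canonical model seen from outside: frame properties can be read off from schemes
  true throughout the model, without mention of maximal consistent sets.\<close>

locale tight_model =
  fixes X :: "'a set" and R E :: "'a rel" and V :: "nat \<Rightarrow> 'a set"
  assumes tight_R: "(x, y) \<in> R \<longleftrightarrow> x \<in> X \<and> y \<in> X \<and> (\<forall>a. sat R E V x (Box a) \<longrightarrow> sat R E V y a)"
    and tight_E: "(x, y) \<in> E \<longleftrightarrow> x \<in> X \<and> y \<in> X \<and> (\<forall>a. sat R E V x (All a) \<longrightarrow> sat R E V y a)"

theorem (in normal_logic) canonical_model:
  assumes "a \<notin> M"
  obtains X :: "fm set set" and R E V x
  where "tight_model X R E V" "\<And>b x. b \<in> M \<Longrightarrow> x \<in> X \<Longrightarrow> sat R E V x b" "x \<in> X" "\<not> sat R E V x a"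
proof -
  let ?X = "{x. mcs M x}"
  let ?R = "{(x, y). mcs M x \<and> mcs M y \<and> (\<forall>b. Box b \<in> x \<longrightarrow> b \<in> y)}"
  let ?E = "{(x, y). mcs M x \<and> mcs M y \<and> (\<forall>b. All b \<in> x \<longrightarrow> b \<in> y)}"
  let ?V = "\<lambda>n. {x. Var n \<in> x}"
  have truth: "sat ?R ?E ?V x b \<longleftrightarrow> b \<in> x" if "mcs M x" for x b
    using that
  proof (induction b arbitrary: x)
    case (Dia b)
    then show ?case using mcs_diamond[OF normal_Dia Dia.prems, of b] by auto
  next
    case (Ex b)
    then show ?case using mcs_diamond[OF normal_Ex Ex.prems, of b] by auto
  qed (simp_all add: mcs_Bot mcs_Imp)
  have "tight_model ?X ?R ?E ?V"
  proof
    fix x y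
    show "(x, y) \<in> ?R \<longleftrightarrow> x \<in> ?X \<and> y \<in> ?X \<and> (\<forall>a. sat ?R ?E ?V x (Box a) \<longrightarrow> sat ?R ?E ?V y a)"
      using truth[of x] truth[of y] by (auto simp del: sat.simps)
    show "(x, y) \<in> ?E \<longleftrightarrow> x \<in> ?X \<and> y \<in> ?X \<and> (\<forall>a. sat ?R ?E ?V x (All a) \<longrightarrow> sat ?R ?E ?V y a)"
      using truth[of x] truth[of y] by (auto simp del: sat.simps)
  qed
  moreover have "\<not> derivable M {Neg a} Bot"
    using assms deduction derivable_empty axDN MP_closed by blast
  then obtain x where x: "Neg a \<in> x" "mcs M x" using Lindenbaum by blast
  then have "a \<notin> x" using mcs_Imp mcs_Bot by blast
  ultimately show thesis
    using that[of ?X ?R ?E ?V x] truth mcs_logic x(2) by (metis (no_types, lifting) mem_Collect_eq)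
qed

section \<open>The finite quotient\<close>

text \<open>Commutation is assumed of formulae, not of \<open>R\<close> and \<open>E\<close> as
  relations.\<close>

locale comm_model =
  fixes X :: "'a set" and R E :: "'a rel" and V :: "nat \<Rightarrow> 'a set" and \<Sigma> :: "fm set"
  assumes R_sub: "R \<subseteq> X \<times> X" and trans_R: "trans R" and equiv_E: "equiv X E"
    and ex_dia: "x \<in> X \<Longrightarrow> sat R E V x (Ex (Dia a)) \<Longrightarrow> sat R E V x (Dia (Ex a))"
    and dia_ex: "x \<in> X \<Longrightarrow> sat R E V x (Dia (Ex a)) \<Longrightarrow> sat R E V x (Ex (Dia a))"
    and finite_\<Sigma>: "finite \<Sigma>"
    and \<Sigma>_Imp: "Imp a b \<in> \<Sigma> \<Longrightarrow> a \<in> \<Sigma> \<and> b \<in> \<Sigma>"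
    and \<Sigma>_Dia: "Dia a \<in> \<Sigma> \<Longrightarrow> a \<in> \<Sigma>"
    and \<Sigma>_Ex: "Ex a \<in> \<Sigma> \<Longrightarrow> a \<in> \<Sigma>"
begin

abbreviation holds :: "'a \<Rightarrow> fm \<Rightarrow> bool" where "holds \<equiv> sat R E V"

definition ty :: "'a \<Rightarrow> fm set" where
  "ty x = {a \<in> \<Sigma>. holds x a}"

definition cty :: "'a \<Rightarrow> fm set set" where
  "cty x = ty ` (E `` {x})"

text \<open>The axioms speak of formulae. A property of points can be fed to them once some formula,
  not necessarily in \<open>\<Sigma>\<close>, defines it.\<close>

definition definable :: "('a \<Rightarrow> bool) \<Rightarrow> bool" where
  "definable P \<longleftrightarrow> (\<exists>a. \<forall>x\<in>X. holds x a \<longleftrightarrow> P x)"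

definition invariant :: "('a \<Rightarrow> bool) \<Rightarrow> bool" where
  "invariant P \<longleftrightarrow> (\<forall>x y. (x, y) \<in> E \<longrightarrow> P x \<longrightarrow> P y)"

lemma E_sub: "E \<subseteq> X \<times> X"
  using equiv_E by (simp add: equiv_def refl_on_def)

lemma E_refl: "x \<in> X \<Longrightarrow> (x, x) \<in> E"
  using equiv_E by (simp add: equiv_def refl_on_def)

lemma E_sym: "(x, y) \<in> E \<Longrightarrow> (y, x) \<in> E"
  using equiv_E by (simp add: equiv_def sym_def)

lemma E_trans: "(x, y) \<in> E \<Longrightarrow> (y, z) \<in> E \<Longrightarrow> (x, z) \<in> E"
  using equiv_E unfolding equiv_def trans_def by blast

lemma R_trans: "(x, y) \<in> R \<Longrightarrow> (y, z) \<in> R \<Longrightarrow> (x, z) \<in> R"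
  using trans_R by (rule transD)

lemma E_in: "(x, y) \<in> E \<Longrightarrow> x \<in> X \<and> y \<in> X"
  using E_sub by blast

lemma R_in: "(x, y) \<in> R \<Longrightarrow> x \<in> X \<and> y \<in> X"
  using R_sub by blast

section \<open>Definable properties of points\<close>

lemma definable_holds: "definable (\<lambda>x. holds x a)"
  unfolding definable_def by (rule exI[of _ a]) simp

lemma definable_const: "definable (\<lambda>x. c)"
proof (cases c)
  case True
  then show ?thesis unfolding definable_def by (intro exI[of _ "Imp Bot Bot"]) simp
next
  case False
  then show ?thesis unfolding definable_def by (intro exI[of _ Bot]) simp
qed

lemma definable_imp:
  assumes "definable P" "definable Q"
  shows "definable (\<lambda>x. P x \<longrightarrow> Q x)"
proof -
  obtain a b where "\<forall>x\<in>X. holds x a \<longleftrightarrow> P x" "\<forall>x\<in>X. holds x b \<longleftrightarrow> Q x"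
    using assms unfolding definable_def by auto
  then show ?thesis unfolding definable_def by (intro exI[of _ "Imp a b"]) simp
qed

lemma definable_not: "definable P \<Longrightarrow> definable (\<lambda>x. \<not> P x)"
  using definable_imp[OF _ definable_const, of P False] by simp

lemma definable_conj: "definable P \<Longrightarrow> definable Q \<Longrightarrow> definable (\<lambda>x. P x \<and> Q x)"
  using definable_not[OF definable_imp[OF _ definable_not]] by simp

lemma definable_disj: "definable P \<Longrightarrow> definable Q \<Longrightarrow> definable (\<lambda>x. P x \<or> Q x)"
  using definable_imp[OF definable_not] by (simp add: disj_imp)

lemma definable_iff: "definable P \<Longrightarrow> definable Q \<Longrightarrow> definable (\<lambda>x. P x \<longleftrightarrow> Q x)"
  using definable_conj[OF definable_imp definable_imp] by (simp add: iff_conv_conj_imp)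

lemma definable_ball:
  assumes "finite A" "\<And>i. i \<in> A \<Longrightarrow> definable (P i)"
  shows "definable (\<lambda>x. \<forall>i\<in>A. P i x)"
  using assms
proof (induction A)
  case empty
  then show ?case using definable_const[of True] by simp
next
  case (insert i A)
  then show ?case using definable_conj[of "P i" "\<lambda>x. \<forall>i\<in>A. P i x"] by simp
qed

lemma definable_dia:
  assumes "definable P"
  shows "definable (\<lambda>x. \<exists>y. (x, y) \<in> R \<and> P y)"
proof -
  obtain a where "\<forall>x\<in>X. holds x a \<longleftrightarrow> P x"
    using assms unfolding definable_def by auto
  then show ?thesis using R_in unfolding definable_def by (intro exI[of _ "Dia a"]) auto
qed

lemma definable_ex:
  assumes "definable P"
  shows "definable (\<lambda>x. \<exists>y. (x, y) \<in> E \<and> P y)"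
proof -
  obtain a where "\<forall>x\<in>X. holds x a \<longleftrightarrow> P x"
    using assms unfolding definable_def by auto
  then show ?thesis using E_in unfolding definable_def by (intro exI[of _ "Ex a"]) auto
qed

lemma definable_box:
  assumes "definable P"
  shows "definable (\<lambda>x. \<forall>y. (x, y) \<in> R \<longrightarrow> P y)"
  using definable_not[OF definable_dia[OF definable_not[OF assms]]] by simp

lemma definable_ty: "definable (\<lambda>x. ty x = t)"
proof -
  \<comment> \<open>Finiteness of \<open>\<Sigma>\<close> turns the description of a type into a
    finite conjunction.\<close>
  have eq: "ty x = t \<longleftrightarrow> t \<subseteq> \<Sigma> \<and> (\<forall>a\<in>\<Sigma>. a \<in> t \<longleftrightarrow> holds x a)" for x
    unfolding ty_def by blast
  show ?thesis
    unfolding eq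
    by (intro definable_conj definable_ball definable_iff definable_const definable_holds finite_\<Sigma>)
qed

lemma cty_sub: "cty x \<in> Pow (Pow \<Sigma>)"
  by (auto simp: cty_def ty_def)

lemma mem_cty: "t \<in> cty x \<longleftrightarrow> (\<exists>y. (x, y) \<in> E \<and> ty y = t)"
  by (auto simp: cty_def)

lemma ty_in_cty: "x \<in> X \<Longrightarrow> ty x \<in> cty x"
  using E_refl by (auto simp: mem_cty)

lemma definable_cty: "definable (\<lambda>x. cty x = q)"
proof -
  \<comment> \<open>Which of the finitely many types occur in the class is a finite conjunction of
    \<open>Ex\<close> statements and negations of such. The constant conjunct handles a
    \<open>q\<close> that is not a set of subsets of \<open>\<Sigma>\<close>.\<close>
  have eq: "cty x = q \<longleftrightarrow> q \<in> Pow (Pow \<Sigma>) \<and> (\<forall>t\<in>Pow \<Sigma>. t \<in> q \<longleftrightarrow> t \<in> cty x)" for x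
  proof
    assume "q \<in> Pow (Pow \<Sigma>) \<and> (\<forall>t\<in>Pow \<Sigma>. t \<in> q \<longleftrightarrow> t \<in> cty x)"
    then have *: "q \<subseteq> Pow \<Sigma>" "\<And>t. t \<in> Pow \<Sigma> \<Longrightarrow> t \<in> q \<longleftrightarrow> t \<in> cty x" by auto
    have "cty x \<subseteq> Pow \<Sigma>" using cty_sub[of x] by simp
    show "cty x = q"
    proof (rule subset_antisym; rule subsetI)
      fix t assume "t \<in> cty x"
      then show "t \<in> q" using \<open>cty x \<subseteq> Pow \<Sigma>\<close> *(2)[of t] by (simp only: subsetD)
    next
      fix t assume "t \<in> q"
      then show "t \<in> cty x" using *(1) *(2)[of t] by (simp only: subsetD)
    qed
  qed (use cty_sub[of x] in simp)
  have "definable (\<lambda>x. q \<in> Pow (Pow \<Sigma>) \<and> (\<forall>t\<in>Pow \<Sigma>. t \<in> q \<longleftrightarrow> t \<in> cty x))"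
    unfolding mem_cty
    by (intro definable_conj definable_ball definable_iff definable_const definable_ex definable_ty
        finite_Pow_iff[THEN iffD2] finite_\<Sigma>)
  then show ?thesis by (simp only: eq)
qed

lemma cty_E:
  assumes "(x, y) \<in> E"
  shows "cty x = cty y"
proof -
  have "E `` {x} = E `` {y}" using equiv_class_eq[OF equiv_E assms] .
  then show ?thesis by (simp add: cty_def)
qed

lemma invariant_cty: "invariant (\<lambda>x. cty x = q)"
  using cty_E by (simp add: invariant_def)

text \<open>Commutation up to a definable property: the point \<open>v\<close> that is reached
  shares \<open>P\<close> with \<open>z\<close> but may differ from it.\<close>

lemma E_R_definable:
  assumes "definable P" "(x, y) \<in> E" "(y, z) \<in> R" "P z"
  shows "\<exists>u v. (x, u) \<in> R \<and> (u, v) \<in> E \<and> P v"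
proof -
  obtain a where a: "\<forall>x\<in>X. holds x a \<longleftrightarrow> P x"
    using assms(1) unfolding definable_def by auto
  then have "holds x (Ex (Dia a))" using assms R_in[OF assms(3)] by auto
  then have "holds x (Dia (Ex a))" using ex_dia E_in[OF assms(2)] by blast
  then obtain u v where "(x, u) \<in> R" "(u, v) \<in> E" "holds v a" by auto
  then show ?thesis using a E_in[of u v] by blast
qed

lemma R_E_definable:
  assumes "definable P" "(x, y) \<in> R" "(y, z) \<in> E" "P z"
  shows "\<exists>u v. (x, u) \<in> E \<and> (u, v) \<in> R \<and> P v"
proof -
  obtain a where a: "\<forall>x\<in>X. holds x a \<longleftrightarrow> P x"
    using assms(1) unfolding definable_def by auto
  then have "holds x (Dia (Ex a))" using assms E_in[OF assms(3)] by auto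
  then have "holds x (Ex (Dia a))" using dia_ex R_in[OF assms(2)] by blast
  then obtain u v where "(x, u) \<in> E" "(u, v) \<in> R" "holds v a" by auto
  then show ?thesis using a R_in[of u v] by blast
qed

text \<open>For a property of whole classes the final \<open>E\<close>-step can be undone. Hence
  equivalent points see the same definable invariant properties.\<close>

lemma invariant_dia_step:
  assumes "definable P" "invariant P" "(x, y) \<in> E" "(y, z) \<in> R" "P z"
  shows "\<exists>u. (x, u) \<in> R \<and> P u"
proof -
  obtain u v where uv: "(x, u) \<in> R" "(u, v) \<in> E" "P v"
    using E_R_definable[OF assms(1,3,4,5)] by blast
  then have "P u" using assms(2) E_sym[OF uv(2)] unfolding invariant_def by blast
  with uv(1) show ?thesis by blast
qed

text \<open>The point itself is included because \<open>R\<close> may fail to be reflexive.\<close>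

definition gone :: "fm set set \<Rightarrow> 'a \<Rightarrow> bool" where
  "gone q y \<longleftrightarrow> cty y \<noteq> q \<and> (\<forall>u. (y, u) \<in> R \<longrightarrow> cty u \<noteq> q)"

lemma gone_R: "gone q y \<Longrightarrow> (y, z) \<in> R \<Longrightarrow> gone q z"
  unfolding gone_def using R_trans by blast

lemma definable_gone: "definable (gone q)"
  unfolding gone_def[abs_def]
  by (intro definable_conj definable_not definable_cty definable_box)

lemma invariant_gone: "invariant (gone q)"
  unfolding invariant_def
proof (intro allI impI)
  fix x y assume xy: "(x, y) \<in> E" and g: "gone q x"
  have "cty u \<noteq> q" if "(y, u) \<in> R" for u
    using invariant_dia_step[OF definable_cty invariant_cty xy that] g unfolding gone_def by blast
  then show "gone q y" using g cty_E[OF xy] by (simp add: gone_def)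
qed

text \<open>Counting only points where the class type of \<open>x\<close> is gone keeps
  \<open>cty x\<close> out of \<open>fut x\<close>; irreflexivity of the finite order comes from
  this.\<close>

definition fut :: "'a \<Rightarrow> fm set set set" where
  "fut x = {cty y | y. (x, y) \<in> R \<and> gone (cty x) y}"

lemma fut_sub: "fut x \<in> Pow (Pow (Pow \<Sigma>))"
  using cty_sub unfolding fut_def by blast

lemma cty_notin_fut: "cty x \<notin> fut x"
  unfolding fut_def gone_def by blast

text \<open>Sharing the class type of \<open>z\<close> with \<open>cty x\<close> gone is definable
  and invariant, so a witness seen from any point of the class of \<open>x\<close> can be replaced
  by one seen from \<open>x\<close>.\<close>

lemma fut_intro:
  assumes "(x, y) \<in> E" "(y, z) \<in> R" "gone (cty x) z"
  shows "cty z \<in> fut x"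
proof -
  let ?P = "\<lambda>w. cty w = cty z \<and> gone (cty x) w"
  have "definable ?P" by (intro definable_conj definable_cty definable_gone)
  moreover have "invariant ?P"
    using invariant_cty invariant_gone unfolding invariant_def by blast
  ultimately obtain u where "(x, u) \<in> R" "?P u"
    using invariant_dia_step[of ?P, OF _ _ assms(1,2)] assms(3) by blast
  then show ?thesis unfolding fut_def by (intro CollectI exI[of _ u]) simp
qed

text \<open>The condition of Lemmon's transitive filtration, written for diamonds.\<close>

definition step :: "fm set \<Rightarrow> fm set \<Rightarrow> bool" where
  "step t s \<longleftrightarrow> (\<forall>a. Dia a \<in> \<Sigma> \<longrightarrow> a \<in> s \<or> Dia a \<in> s \<longrightarrow> Dia a \<in> t)"

lemma step_trans: "step s t \<Longrightarrow> step t u \<Longrightarrow> step s u"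
  unfolding step_def by blast

lemma step_R:
  assumes "(x, y) \<in> R"
  shows "step (ty x) (ty y)"
  unfolding step_def ty_def using assms R_trans[OF assms] by auto

text \<open>A class is good when every point in it (up to type) has all its diamonds witnessed at
  points from which the class type never recurs. The Boolean \<open>r\<close> allows a reflexive point to
  witness its own diamonds.\<close>

definition good :: "bool \<Rightarrow> 'a \<Rightarrow> bool" where
  "good r x \<longleftrightarrow> x \<in> X \<and> (\<forall>t\<in>cty x. \<exists>z. (x, z) \<in> E \<and> ty z = t \<and>
     (\<forall>a. Dia a \<in> \<Sigma> \<longrightarrow> holds z (Dia a) \<longrightarrow>
        r \<and> holds z a \<or> (\<exists>w. (z, w) \<in> R \<and> holds w a \<and> gone (cty x) w)))"

lemma goodD:
  assumes "good r x" "t \<in> cty x"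
  shows "\<exists>z. (x, z) \<in> E \<and> ty z = t \<and>
     (\<forall>a. Dia a \<in> \<Sigma> \<longrightarrow> holds z (Dia a) \<longrightarrow>
        r \<and> holds z a \<or> (\<exists>w. (z, w) \<in> R \<and> holds w a \<and> gone (cty x) w))"
  using assms unfolding good_def by (elim conjE) (rule bspec)

section \<open>The finite frame of triples\<close>

type_synonym point = "fm set set \<times> fm set set set \<times> fm set"

definition points :: "bool \<Rightarrow> point set" where
  "points r = {(cty x, fut x, t) | x t. good r x \<and> t \<in> cty x}"

definition below :: "bool \<Rightarrow> point rel" where
  "below r = {((q, F, t), (q', F', t')).
     (q, F, t) \<in> points r \<and> (q', F', t') \<in> points r \<and> q' \<in> F \<and> F' \<subseteq> F \<and>
     (\<forall>t\<in>q. \<exists>s\<in>q'. step t s) \<and> (\<forall>s\<in>q'. \<exists>t\<in>q. step t s) \<and> step t t'}"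

definition same :: "bool \<Rightarrow> point rel" where
  "same r = {((q, F, t), (q', F', t')).
     (q, F, t) \<in> points r \<and> (q', F', t') \<in> points r \<and> q = q' \<and> F = F'}"

lemma below_iff: "((q, F, t), (q', F', t')) \<in> below r \<longleftrightarrow>
    (q, F, t) \<in> points r \<and> (q', F', t') \<in> points r \<and> q' \<in> F \<and> F' \<subseteq> F \<and>
    (\<forall>t\<in>q. \<exists>s\<in>q'. step t s) \<and> (\<forall>s\<in>q'. \<exists>t\<in>q. step t s) \<and> step t t'"
  by (simp add: below_def)

lemma same_iff: "((q, F, t), (q', F', t')) \<in> same r \<longleftrightarrow>
    (q, F, t) \<in> points r \<and> (q', F', t') \<in> points r \<and> q = q' \<and> F = F'"
  by (simp add: same_def)

lemma points_cases:
  assumes "p \<in> points r"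
  obtains x t where "p = (cty x, fut x, t)" "good r x" "t \<in> cty x"
  using assms unfolding points_def by blast

lemma points_same_class:
  assumes "(q, F, t) \<in> points r"
  shows "(q, F, s) \<in> points r \<longleftrightarrow> s \<in> q"
  using assms unfolding points_def by auto

lemma strict_frame_below: "strict_frame (points r) (below r) (same r)"
proof
  have "points r \<subseteq> Pow (Pow \<Sigma>) \<times> Pow (Pow (Pow \<Sigma>)) \<times> Pow \<Sigma>"
  proof
    fix p assume "p \<in> points r"
    then obtain x t where "p = (cty x, fut x, t)" "t \<in> cty x" by (rule points_cases)
    then show "p \<in> Pow (Pow \<Sigma>) \<times> Pow (Pow (Pow \<Sigma>)) \<times> Pow \<Sigma>"
      using cty_sub[of x] fut_sub[of x] by auto
  qed
  then show "finite (points r)"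
    by (rule finite_subset) (simp add: finite_\<Sigma>)
  show "below r \<subseteq> points r \<times> points r"
    by (auto simp: below_def)
  show "trans (below r)"
  proof (rule transI)
    fix p1 p2 p3 assume b: "(p1, p2) \<in> below r" "(p2, p3) \<in> below r"
    obtain q1 F1 t1 where p1: "p1 = (q1, F1, t1)" by (rule prod_cases3)
    obtain q2 F2 t2 where p2: "p2 = (q2, F2, t2)" by (rule prod_cases3)
    obtain q3 F3 t3 where p3: "p3 = (q3, F3, t3)" by (rule prod_cases3)
    note p = p1 p2 p3
    note b1 = b(1)[unfolded p below_iff] and b2 = b(2)[unfolded p below_iff]
    from b1 have f1: "\<forall>t\<in>q1. \<exists>s\<in>q2. step t s" and g1: "\<forall>s\<in>q2. \<exists>t\<in>q1. step t s" by simp_all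
    from b2 have f2: "\<forall>t\<in>q2. \<exists>s\<in>q3. step t s" and g2: "\<forall>s\<in>q3. \<exists>t\<in>q2. step t s" by simp_all
    have "\<exists>s\<in>q3. step t s" if "t \<in> q1" for t
    proof -
      obtain s where "s \<in> q2" "step t s" using f1 \<open>t \<in> q1\<close> by blast
      moreover obtain u where "u \<in> q3" "step s u" using f2 \<open>s \<in> q2\<close> by blast
      ultimately show ?thesis using step_trans[of t s u] by blast
    qed
    moreover have "\<exists>t\<in>q1. step t s" if "s \<in> q3" for s
    proof -
      obtain t where "t \<in> q2" "step t s" using g2 \<open>s \<in> q3\<close> by blast
      moreover obtain u where "u \<in> q1" "step u t" using g1 \<open>t \<in> q2\<close> by blast
      ultimately show ?thesis using step_trans[of u t s] by blast
    qed
    moreover have "step t1 t3" using step_trans[of t1 t2 t3] b1 b2 by simp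
    moreover from b1 b2 have "q2 \<in> F1" "F2 \<subseteq> F1" "q3 \<in> F2" "F3 \<subseteq> F2" by simp_all
    then have "q3 \<in> F1" "F3 \<subseteq> F1" by blast+
    ultimately show "(p1, p3) \<in> below r"
      unfolding p below_iff using b1 b2 by simp
  qed
  show "irrefl (below r)"
  proof (rule irreflI)
    fix p show "(p, p) \<notin> below r"
    proof
      assume b: "(p, p) \<in> below r"
      then have "p \<in> points r" by (auto simp: below_def)
      then obtain x t where p: "p = (cty x, fut x, t)" by (rule points_cases)
      \<comment> \<open>A loop would put \<open>cty x\<close> into \<open>fut x\<close>.\<close>
      show False using b[unfolded p below_iff] cty_notin_fut by simp
    qed
  qed
  show "equiv (points r) (same r)"
  proof (rule equivI)
    show "same r \<subseteq> points r \<times> points r" by (auto simp: same_def)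
    show "refl_on (points r) (same r)" by (rule refl_onI) (auto simp: same_def)
    show "sym (same r)" by (rule symI) (auto simp: same_def)
    show "trans (same r)" by (rule transI) (auto simp: same_def)
  qed
  show "same r O below r = below r O same r"
  proof (intro subset_antisym subrelI)
    fix p p' assume "(p, p') \<in> same r O below r"
    then obtain m where m: "(p, m) \<in> same r" "(m, p') \<in> below r" by blast
    obtain q F t where p1: "p = (q, F, t)" by (rule prod_cases3)
    obtain q1 F1 t1 where p2: "m = (q1, F1, t1)" by (rule prod_cases3)
    obtain q' F' t' where p3: "p' = (q', F', t')" by (rule prod_cases3)
    note p = p1 p2 p3
    note m = m[unfolded p same_iff below_iff]
    have "q1 = q" "F1 = F" using m by simp_all
    note m = m[unfolded this]
    have pts: "(q, F, t) \<in> points r" "(q', F', t') \<in> points r" using m by simp_all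
    have "t \<in> q" using points_same_class[OF pts(1)] pts(1) by blast
    \<comment> \<open>Apart from the \<open>step\<close> between the two third components,
      \<open>below\<close> looks only at class data. So it suffices to change the target type to
      some \<open>s\<close> in \<open>q'\<close> with \<open>step t s\<close>.\<close>
    moreover have "\<forall>t\<in>q. \<exists>s\<in>q'. step t s" using m by simp
    ultimately obtain s where s: "s \<in> q'" "step t s" by blast
    then have "(q', F', s) \<in> points r" using points_same_class[OF pts(2)] by blast
    then have "(p, (q', F', s)) \<in> below r" "((q', F', s), p') \<in> same r"
      unfolding p same_iff below_iff using m s pts by simp_all
    then show "(p, p') \<in> below r O same r" by blast
  next
    fix p p' assume "(p, p') \<in> below r O same r"
    then obtain m where m: "(p, m) \<in> below r" "(m, p') \<in> same r" by blast
    obtain q F t where p1: "p = (q, F, t)" by (rule prod_cases3)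
    obtain q1 F1 t1 where p2: "m = (q1, F1, t1)" by (rule prod_cases3)
    obtain q' F' t' where p3: "p' = (q', F', t')" by (rule prod_cases3)
    note p = p1 p2 p3
    note m = m[unfolded p same_iff below_iff]
    have "q1 = q'" "F1 = F'" using m by simp_all
    note m = m[unfolded this]
    have pts: "(q, F, t) \<in> points r" "(q', F', t') \<in> points r" using m by simp_all
    have "t' \<in> q'" using points_same_class[OF pts(2)] pts(2) by blast
    moreover have "\<forall>s\<in>q'. \<exists>t\<in>q. step t s" using m by simp
    ultimately obtain s where s: "s \<in> q" "step s t'" by blast
    then have "(q, F, s) \<in> points r" using points_same_class[OF pts(1)] by blast
    then have "((q, F, s), p') \<in> below r" "(p, (q, F, s)) \<in> same r"
      unfolding p same_iff below_iff using m s pts by simp_all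
    then show "(p, p') \<in> same r O below r" by blast
  qed
qed

text \<open>Here \<open>w\<close> is the witness of a diamond at \<open>z\<close>, and
  \<open>v\<close> a good representative of its class type found at or above \<open>w\<close>. The
  type of \<open>w\<close> can be kept, as it still occurs in the class of \<open>v\<close>.\<close>

lemma below_witness:
  assumes "good r x" "good r v" "(x, z) \<in> E" "(z, w) \<in> R" "gone (cty x) w"
    and v: "v = w \<or> (w, v) \<in> R" "cty v = cty w"
  shows "((cty x, fut x, ty z), (cty v, fut v, ty w)) \<in> below r"
proof -
  have wX: "w \<in> X" using R_in assms(4) by blast
  have zx: "(z, x) \<in> E" using E_sym assms(3) by blast
  have "ty z \<in> cty x" using assms(3) by (auto simp: mem_cty)
  then have p1: "(cty x, fut x, ty z) \<in> points r"
    using assms(1) unfolding points_def by blast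
  have "ty w \<in> cty v" using v(2) ty_in_cty[OF wX] by simp
  then have p2: "(cty v, fut v, ty w) \<in> points r"
    using assms(2) unfolding points_def by blast
  have in_fut: "cty v \<in> fut x"
    using fut_intro[OF assms(3,4,5)] v(2) by simp
  \<comment> \<open>Whatever \<open>v\<close> sees is seen from \<open>w\<close>, where
    \<open>cty x\<close> is already gone and remains so.\<close>
  have fut: "fut v \<subseteq> fut x"
  proof
    fix q assume "q \<in> fut v"
    then obtain u where u: "q = cty u" "(v, u) \<in> R" unfolding fut_def by blast
    then have wu: "(w, u) \<in> R" using v(1) R_trans by blast
    then show "q \<in> fut x"
      using fut_intro[OF assms(3) R_trans[OF assms(4) wu] gone_R[OF assms(5) wu]] u(1) by simp
  qed
  \<comment> \<open>Class types are invariant, so every point of the class of \<open>x\<close> sees,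
    like \<open>z\<close>, the class type of \<open>w\<close>.\<close>
  have forward: "\<exists>s\<in>cty v. step t s" if "t \<in> cty x" for t
  proof -
    obtain y where y: "(x, y) \<in> E" "ty y = t" using \<open>t \<in> cty x\<close> by (auto simp: mem_cty)
    have "(y, z) \<in> E" using E_trans[OF E_sym[OF y(1)] assms(3)] .
    from invariant_dia_step[OF definable_cty invariant_cty this assms(4) refl]
    obtain u where u: "(y, u) \<in> R" "cty u = cty w" by blast
    then have "ty u \<in> cty v" using v(2) ty_in_cty R_in[OF u(1)] by metis
    with step_R[OF u(1)] y(2) show ?thesis by blast
  qed
  \<comment> \<open>By the converse commutation axiom, each type in the class of \<open>w\<close> is
    realized by a successor of some point in the class of \<open>z\<close>.\<close>
  have backward: "\<exists>t\<in>cty x. step t s" if "s \<in> cty v" for s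
  proof -
    obtain y where y: "(w, y) \<in> E" "ty y = s" using \<open>s \<in> cty v\<close> v(2) by (auto simp: mem_cty)
    from R_E_definable[OF definable_ty assms(4) y]
    obtain u u' where u: "(z, u) \<in> E" "(u, u') \<in> R" "ty u' = s" by blast
    have "ty u \<in> cty x" using E_trans[OF assms(3) u(1)] by (auto simp: mem_cty)
    with step_R[OF u(2)] u(3) show ?thesis by blast
  qed
  show ?thesis
    unfolding below_iff using p1 p2 in_fut fut forward backward step_R[OF assms(4)] by simp
qed

section \<open>The truth lemma\<close>

definition qval :: "bool \<Rightarrow> nat \<Rightarrow> point set" where
  "qval r n = {(q, F, t). (q, F, t) \<in> points r \<and> Var n \<in> t}"

definition below_r :: "bool \<Rightarrow> point rel" where
  "below_r r = below r \<union> (if r then Id_on (points r) else {})"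

lemma truth:
  assumes good_above: "\<And>y. y \<in> X \<Longrightarrow> \<exists>v. (v = y \<or> (y, v) \<in> R) \<and> cty v = cty y \<and> good r v"
    and refl: "\<And>x. r \<Longrightarrow> x \<in> X \<Longrightarrow> (x, x) \<in> R"
    and "a \<in> \<Sigma>" "(q, F, t) \<in> points r"
  shows "sat (below_r r) (same r) (qval r) (q, F, t) a \<longleftrightarrow> a \<in> t"
  using assms(3,4)
proof (induction a arbitrary: q F t)
  case (Var n)
  then show ?case by (simp add: qval_def)
next
  case Bot
  from Bot(2) obtain x where "t \<in> cty x" by (auto elim: points_cases)
  then show ?case by (auto simp: mem_cty ty_def)
next
  case (Imp a b)
  from Imp.prems(2) obtain x where "t \<in> cty x" by (auto elim: points_cases)
  then obtain z where t: "t = ty z" by (auto simp: mem_cty)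
  have "a \<in> \<Sigma>" "b \<in> \<Sigma>" using \<Sigma>_Imp[OF Imp.prems(1)] by auto
  then show ?case
    using Imp.IH(1)[OF _ Imp.prems(2)] Imp.IH(2)[OF _ Imp.prems(2)] Imp.prems(1)
    by (simp add: t ty_def)
next
  case (Ex a)
  have a: "a \<in> \<Sigma>" using \<Sigma>_Ex Ex.prems(1) by blast
  obtain x where x: "q = cty x" "F = fut x" "good r x" "t \<in> cty x"
    using Ex.prems(2) by (auto elim: points_cases)
  then obtain z where z: "(x, z) \<in> E" "t = ty z" by (auto simp: mem_cty)
  have "sat (below_r r) (same r) (qval r) (q, F, t) (Ex a) \<longleftrightarrow>
      (\<exists>s. (q, F, s) \<in> points r \<and> sat (below_r r) (same r) (qval r) (q, F, s) a)"
    using Ex.prems(2) by (auto simp: same_def)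
  also have "\<dots> \<longleftrightarrow> (\<exists>s\<in>cty x. a \<in> s)"
    using Ex.IH[OF a] points_same_class[OF Ex.prems(2)] x(1) by blast
  also have "\<dots> \<longleftrightarrow> (\<exists>y. (x, y) \<in> E \<and> holds y a)"
    using a by (simp add: cty_def ty_def Bex_def image_iff) blast
  also have "\<dots> \<longleftrightarrow> holds z (Ex a)"
    using E_trans[OF z(1)] E_trans[OF E_sym[OF z(1)]] by auto
  finally show ?case using Ex.prems(1) by (simp add: z(2) ty_def)
next
  case (Dia a)
  have a: "a \<in> \<Sigma>" using \<Sigma>_Dia Dia.prems(1) by blast
  obtain x where x: "q = cty x" "F = fut x" "good r x" "t \<in> cty x"
    using Dia.prems(2) by (auto elim: points_cases)
  \<comment> \<open>Several points of the class may realize \<open>t\<close>; goodness provides one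
    whose diamonds all have usable witnesses.\<close>
  obtain z where z: "(x, z) \<in> E" "ty z = t" and wits: "\<forall>a. Dia a \<in> \<Sigma> \<longrightarrow> holds z (Dia a) \<longrightarrow>
      r \<and> holds z a \<or> (\<exists>w. (z, w) \<in> R \<and> holds w a \<and> gone (cty x) w)"
    using goodD[OF x(3,4)] by (elim exE conjE)
  note z = z(1) z(2)[symmetric] and wit = wits[rule_format, OF Dia.prems(1)]
  show ?case
  proof
    assume "sat (below_r r) (same r) (qval r) (q, F, t) (Dia a)"
    then obtain p where p: "((q, F, t), p) \<in> below_r r" "sat (below_r r) (same r) (qval r) p a" by auto
    obtain q' F' t' where p_eq: "p = (q', F', t')" by (cases p)
    show "Dia a \<in> t"
    proof (cases "((q, F, t), p) \<in> below r")
      case True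
      then have "step t t'" "(q', F', t') \<in> points r" unfolding p_eq below_iff by auto
      moreover from this(2) have "a \<in> t'" using Dia.IH[OF a] p(2) p_eq by blast
      ultimately show ?thesis using Dia.prems(1) unfolding step_def by blast
    next
      case False
      \<comment> \<open>Outside \<open>below\<close> only the reflexive loop is left, and then
        \<open>R\<close> is reflexive in the original model as well.\<close>
      then have r and "p = (q, F, t)" using p(1) unfolding below_r_def by (auto split: if_splits)
      then have "a \<in> t" using Dia.IH[OF a Dia.prems(2)] p(2) by blast
      then have "holds z a" "z \<in> X" using z E_in by (auto simp: ty_def)
      then have "holds z (Dia a)" using refl[OF \<open>r\<close>] by auto
      then show ?thesis using Dia.prems(1) z(2) by (simp add: ty_def)
    qed
  next
    assume "Dia a \<in> t"
    then have "holds z (Dia a)" by (simp add: z(2) ty_def)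
    from wit[OF this] show "sat (below_r r) (same r) (qval r) (q, F, t) (Dia a)"
    proof
      assume "r \<and> holds z a"
      then have "sat (below_r r) (same r) (qval r) (q, F, t) a" "((q, F, t), (q, F, t)) \<in> below_r r"
        using Dia.IH[OF a Dia.prems(2)] Dia.prems(2) a by (auto simp: z(2) ty_def below_r_def)
      then show ?thesis by auto
    next
      assume "\<exists>w. (z, w) \<in> R \<and> holds w a \<and> gone (cty x) w"
      then obtain w where w: "(z, w) \<in> R" "holds w a" "gone (cty x) w" by blast
      then obtain v where v: "v = w \<or> (w, v) \<in> R" "cty v = cty w" "good r v"
        using good_above[of w] R_in by blast
      have b: "((q, F, t), (cty v, fut v, ty w)) \<in> below r"
        using below_witness[OF x(3) v(3) z(1) w(1,3) v(1,2)] x(1,2) z(2) by simp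
      then have "(cty v, fut v, ty w) \<in> points r" unfolding below_iff by simp
      then have "sat (below_r r) (same r) (qval r) (cty v, fut v, ty w) a"
        using Dia.IH[OF a] w(2) a by (simp add: ty_def)
      moreover have "((q, F, t), (cty v, fut v, ty w)) \<in> below_r r"
        using b by (simp add: below_r_def)
      ultimately show ?thesis by auto
    qed
  qed
qed

lemma refuted_quotient:
  assumes good_above: "\<And>y. y \<in> X \<Longrightarrow> \<exists>v. (v = y \<or> (y, v) \<in> R) \<and> cty v = cty y \<and> good r v"
    and refl: "\<And>x. r \<Longrightarrow> x \<in> X \<Longrightarrow> (x, x) \<in> R"
    and "a \<in> \<Sigma>" "x \<in> X" "\<not> holds x a"
  shows "refuted (points r) (below_r r) (same r) a"
proof -
  \<comment> \<open>The class of \<open>x\<close> may fail to be good, but the type of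
    \<open>x\<close> occurs in the good class of \<open>v\<close>.\<close>
  obtain v where v: "cty v = cty x" "good r v" using good_above[OF assms(4)] by blast
  have "ty x \<in> cty v" using ty_in_cty[OF assms(4)] v(1) by simp
  then have p: "(cty v, fut v, ty x) \<in> points r" using v(2) unfolding points_def by blast
  have "a \<notin> ty x" using assms(5) by (simp add: ty_def)
  then have "\<not> sat (below_r r) (same r) (qval r) (cty v, fut v, ty x) a"
    using truth[OF good_above refl assms(3) p] by blast
  moreover have "qval r n \<subseteq> points r" for n unfolding qval_def by blast
  ultimately show ?thesis using p unfolding refuted_def by (intro exI[of _ "qval r"]) auto
qed

end

section \<open>Subformulae\<close>

primrec sub :: "fm \<Rightarrow> fm set" where
  "sub (Var n) = {Var n}"
| "sub Bot = {Bot}"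
| "sub (Imp a b) = insert (Imp a b) (sub a \<union> sub b)"
| "sub (Dia a) = insert (Dia a) (sub a)"
| "sub (Ex a) = insert (Ex a) (sub a)"

lemma finite_sub: "finite (sub a)"
  by (induction a) auto

lemma sub_refl: "a \<in> sub a"
  by (cases a) auto

lemma sub_closed:
  "Imp b c \<in> sub a \<Longrightarrow> b \<in> sub a \<and> c \<in> sub a"
  "Dia b \<in> sub a \<Longrightarrow> b \<in> sub a"
  "Ex b \<in> sub a \<Longrightarrow> b \<in> sub a"
  by (induction a) (auto simp: sub_refl)

section \<open>Good classes\<close>

lemma sat_MP: "sat R E V x (Imp a b) \<Longrightarrow> sat R E V x a \<Longrightarrow> sat R E V x b"
  by simp

text \<open>Loeb's axiom for a \<open>b\<close> saying that the class type differs from that of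
  \<open>y\<close> yields a last point \<open>v\<close> of this class type, unless \<open>y\<close>
  is one. Successors of the class of \<open>v\<close> have left the class type for good, so every
  diamond witness will do.\<close>

lemma (in comm_model) good_above_GL:
  assumes GL: "\<And>x b. x \<in> X \<Longrightarrow> holds x (Imp (Box (Imp (Box b) b)) (Box b))" and "y \<in> X"
  shows "\<exists>v. (v = y \<or> (y, v) \<in> R) \<and> cty v = cty y \<and> good False v"
proof -
  obtain v where v: "v = y \<or> (y, v) \<in> R" "cty v = cty y" "\<And>u. (v, u) \<in> R \<Longrightarrow> cty u \<noteq> cty y"
  proof (cases "\<exists>u. (y, u) \<in> R \<and> cty u = cty y")
    case True
    obtain b where b: "\<forall>x\<in>X. holds x b \<longleftrightarrow> cty x \<noteq> cty y"
      using definable_not[OF definable_cty] unfolding definable_def by blast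
    have "\<not> holds y (Box b)" using True b R_in by auto
    then have "\<not> holds y (Box (Imp (Box b) b))" using GL[OF assms(2), of b] by (simp only: sat.simps) blast
    then obtain v where v: "(y, v) \<in> R" "holds v (Box b)" "\<not> holds v b"
      by (simp only: sat.simps) blast
    then have "\<And>u. (v, u) \<in> R \<Longrightarrow> holds u b" by simp
    then have "\<And>u. (v, u) \<in> R \<Longrightarrow> cty u \<noteq> cty y" using b R_in by blast
    moreover have "cty v = cty y" using v b R_in by blast
    ultimately show thesis using v(1) that by blast
  next
    case False
    then show thesis using that[of y] by blast
  qed
  have vX: "v \<in> X" using v(1) assms(2) R_in by blast
  have gone: "gone (cty v) w" if z: "(v, z) \<in> E" and w: "(z, w) \<in> R" for z w
  proof -
    \<comment> \<open>A recurrence seen from \<open>z\<close> would be seen from \<open>v\<close>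
      too, since class types are invariant.\<close>
    have "cty u \<noteq> cty v" if "(z, u) \<in> R" for u
      using invariant_dia_step[OF definable_cty invariant_cty z that refl] v(2,3) by metis
    then show ?thesis unfolding gone_def using w R_trans[OF w] by blast
  qed
  have "good False v"
    unfolding good_def
  proof (intro conjI ballI vX)
    fix t assume "t \<in> cty v"
    then obtain z where z: "(v, z) \<in> E" "ty z = t" by (auto simp: mem_cty)
    have "\<exists>w. (z, w) \<in> R \<and> holds w a \<and> gone (cty v) w" if "holds z (Dia a)" for a
      using that gone[OF z(1)] by auto
    with z show "\<exists>z. (v, z) \<in> E \<and> ty z = t \<and> (\<forall>a. Dia a \<in> \<Sigma> \<longrightarrow> holds z (Dia a) \<longrightarrow>
        False \<and> holds z a \<or> (\<exists>w. (z, w) \<in> R \<and> holds w a \<and> gone (cty v) w))"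
      by (intro exI[of _ z]) simp
  qed
  with v(1,2) show ?thesis by blast
qed

section \<open>Strongly maximal points\<close>

locale grz_model = comm_model +
  assumes refl_R: "x \<in> X \<Longrightarrow> (x, x) \<in> R"
    and Grz: "x \<in> X \<Longrightarrow> sat R E V x (Imp (Box (Imp (Box (Imp b (Box b))) b)) b)"
    and Casari: "x \<in> X \<Longrightarrow>
      sat R E V x (Imp (Box (All (Imp (Box (Imp (Box b) (Box (All b)))) (Box (All b))))) (Box (All b)))"
begin

definition strongly_maximal :: "fm set \<Rightarrow> fm set set \<Rightarrow> 'a \<Rightarrow> bool" where
  "strongly_maximal t q z \<longleftrightarrow> (ty z = t \<and> cty z = q) \<and>
     (\<forall>w. (z, w) \<in> R \<longrightarrow> (ty w = t \<and> cty w = q) \<or> gone q w)"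

lemma definable_strongly_maximal: "definable (strongly_maximal t q)"
  unfolding strongly_maximal_def[abs_def]
  by (intro definable_conj definable_ty definable_cty definable_box definable_disj definable_gone)

lemma strongly_maximal_R:
  assumes "strongly_maximal t q z" "(z, w) \<in> R" "cty w = q"
  shows "strongly_maximal t q w"
proof -
  have "\<not> gone q w" using assms(3) by (simp add: gone_def)
  then have "ty w = t" using assms(1,2) unfolding strongly_maximal_def by blast
  then show ?thesis
    using assms R_trans[OF assms(2)] unfolding strongly_maximal_def by blast
qed

text \<open>Both axioms are used with a \<open>b\<close> saying that the type or the class type
  differs from that of \<open>x\<close>. Casari supplies a \<open>y2\<close> at whose successors
  \<open>Box b\<close> forces \<open>Box (All b)\<close>; Grz supplies above it a \<open>z\<close>
  where \<open>b\<close> fails, while at any successor of \<open>z\<close> the truth of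
  \<open>b\<close> entails \<open>Box b\<close>. So a successor of \<open>z\<close> either repeats
  the type and class type of \<open>x\<close> or has left that class type for good.\<close>

lemma strongly_maximal_exists:
  assumes "x \<in> X"
  shows "\<exists>u v. (x, u) \<in> R \<and> (u, v) \<in> E \<and> strongly_maximal (ty x) (cty x) v"
proof -
  let ?P = "\<lambda>w. ty w = ty x \<and> cty w = cty x"
  have "definable (\<lambda>w. \<not> ?P w)"
    by (intro definable_not definable_conj definable_ty definable_cty)
  then obtain b where b: "\<forall>w\<in>X. holds w b \<longleftrightarrow> \<not> ?P w"
    unfolding definable_def by blast
  have "\<not> holds x (Box (All b))"
    using b refl_R[OF assms] E_refl[OF assms] assms by auto
  then have "\<not> holds x (Box (All (Imp (Box (Imp (Box b) (Box (All b)))) (Box (All b)))))"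
    using Casari[OF assms, of b] by (metis sat.simps(3))
  then obtain y1 y2 where y: "(x, y1) \<in> R" "(y1, y2) \<in> E"
    and y2: "holds y2 (Box (Imp (Box b) (Box (All b))))" "\<not> holds y2 (Box (All b))"
    by (simp only: sat.simps) blast
  have y2_imp: "holds w (Box (All b))" if "(y2, w) \<in> R" "holds w (Box b)" for w
    using y2(1) that by (simp only: sat.simps) blast
  have "(y2, y2) \<in> R" using E_in[OF y(2)] refl_R by blast
  then have "\<not> holds y2 (Box b)" using y2_imp y2(2) by blast
  then obtain z0 where z0: "(y2, z0) \<in> R" "\<not> holds z0 b"
    by (simp only: sat.simps) blast
  then have "\<not> holds z0 (Box (Imp (Box (Imp b (Box b))) b))"
    using Grz R_in[OF z0(1)] by (metis sat.simps(3))
  then obtain z where z: "(z0, z) \<in> R" "holds z (Box (Imp b (Box b)))" "\<not> holds z b"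
    by (simp only: sat.simps) blast
  have yz: "(y2, z) \<in> R" using R_trans z0(1) z(1) .
  have Pz: "?P z" using z(3) b R_in[OF z(1)] by blast
  have "gone (cty x) w" if w: "(z, w) \<in> R" "\<not> ?P w" for w
  proof -
    have wX: "w \<in> X" using R_in w(1) by blast
    have "holds w b" using b w(2) wX by blast
    then have "holds w (Box b)" using z(2) w(1) by (simp only: sat.simps) blast
    then have all: "holds w (Box (All b))" using y2_imp R_trans[OF yz w(1)] by blast
    have no: "cty u \<noteq> cty x" if "(w, u) \<in> R" for u
    proof
      assume "cty u = cty x"
      then have "ty x \<in> cty u" using ty_in_cty[OF assms] by simp
      then obtain u' where u': "(u, u') \<in> E" "ty u' = ty x" by (auto simp: mem_cty)
      have "holds u' b" using all \<open>(w, u) \<in> R\<close> u'(1) by (simp only: sat.simps) blast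
      then show False
        using b E_in[OF u'(1)] u'(2) cty_E[OF u'(1)] \<open>cty u = cty x\<close> by simp
    qed
    then show ?thesis unfolding gone_def using refl_R[OF wX] by blast
  qed
  then have "strongly_maximal (ty x) (cty x) z"
    using Pz unfolding strongly_maximal_def by blast
  \<comment> \<open>The point \<open>z\<close> was reached by an \<open>E\<close>-step followed by
    \<open>R\<close>; definability of strong maximality lets the \<open>R\<close>-steps come
    first.\<close>
  from E_R_definable[OF definable_strongly_maximal y(2) yz this]
  obtain u v where u: "(y1, u) \<in> R" "(u, v) \<in> E" "strongly_maximal (ty x) (cty x) v" by blast
  then show ?thesis using R_trans[OF y(1) u(1)] by blast
qed

definition has_sm :: "fm set \<Rightarrow> fm set set \<Rightarrow> 'a \<Rightarrow> bool" where
  "has_sm t q x \<longleftrightarrow> (\<exists>z. (x, z) \<in> E \<and> strongly_maximal t q z)"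

lemma definable_has_sm: "definable (has_sm t q)"
  unfolding has_sm_def[abs_def] by (intro definable_ex definable_strongly_maximal)

lemma has_sm_E: "(x, y) \<in> E \<Longrightarrow> has_sm t q x \<Longrightarrow> has_sm t q y"
  unfolding has_sm_def using E_trans[OF E_sym] by blast

text \<open>A gain made for one type survives as long as the class type does. Otherwise
  \<open>z\<close> would see a point of class type \<open>q\<close> whose class has no strongly
  maximal point, although strong maximality passes from \<open>z\<close> to every successor of class
  type \<open>q\<close>.\<close>

lemma has_sm_R:
  assumes "has_sm t q v" "(v, v') \<in> R" "cty v' = q"
  shows "has_sm t q v'"
proof (rule ccontr)
  assume no: "\<not> has_sm t q v'"
  obtain z where z: "(v, z) \<in> E" "strongly_maximal t q z"
    using assms(1) unfolding has_sm_def by blast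
  let ?P = "\<lambda>w. cty w = q \<and> \<not> has_sm t q w"
  have def: "definable ?P" by (intro definable_conj definable_not definable_cty definable_has_sm)
  have inv: "invariant ?P"
    unfolding invariant_def using cty_E has_sm_E[OF E_sym] by metis
  obtain w where w: "(z, w) \<in> R" "?P w"
    using invariant_dia_step[OF def inv E_sym[OF z(1)] assms(2)] no assms(3) by blast
  then have "strongly_maximal t q w" using strongly_maximal_R[OF z(2)] by blast
  then have "has_sm t q w" unfolding has_sm_def using E_refl R_in[OF w(1)] by blast
  then show False using w(2) by blast
qed

lemma has_sm_above:
  assumes "finite s" "s \<subseteq> cty x" "x \<in> X"
  shows "\<exists>v. (x, v) \<in> R \<and> cty v = cty x \<and> (\<forall>t\<in>s. has_sm t (cty x) v)"
  using assms(1,2)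
proof (induction s)
  case empty
  then show ?case using refl_R[OF assms(3)] by blast
next
  case (insert t s)
  from insert obtain v where v: "(x, v) \<in> R" "cty v = cty x" "\<forall>t\<in>s. has_sm t (cty x) v" by auto
  \<comment> \<open>The class type has not changed, so the next type \<open>t\<close> still occurs
    in the class of \<open>v\<close>, and a strongly maximal point for it can be sought from
    there.\<close>
  have "t \<in> cty v" using insert.prems v(2) by simp
  then obtain x' where x': "(v, x') \<in> E" "ty x' = t" by (auto simp: mem_cty)
  have cx': "cty x' = cty x" using cty_E[OF x'(1)] v(2) by simp
  have "x' \<in> X" using E_in x'(1) by blast
  from strongly_maximal_exists[OF this]
  obtain u z where u: "(x', u) \<in> R" "(u, z) \<in> E" "strongly_maximal t (cty x) z"
    unfolding x'(2) cx' by blast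
  let ?P = "\<lambda>w. cty w = cty x \<and> has_sm t (cty x) w"
  have def: "definable ?P" by (intro definable_conj definable_cty definable_has_sm)
  have inv: "invariant ?P"
    unfolding invariant_def using cty_E has_sm_E by metis
  have "?P u" using u(2,3) cty_E[OF u(2)] unfolding has_sm_def strongly_maximal_def by auto
  \<comment> \<open>Invariance replaces \<open>u\<close>, known to be seen from \<open>x'\<close>,
    by a point seen from \<open>v\<close>.\<close>
  from invariant_dia_step[OF def inv x'(1) u(1) this]
  obtain v' where v': "(v, v') \<in> R" "?P v'" by blast
  have "has_sm t' (cty x) v'" if "t' \<in> insert t s" for t'
    using that v(3) v' has_sm_R[of t' "cty x" v v'] by auto
  then show ?case using v' R_trans[OF v(1) v'(1)] by blast
qed

lemma good_above:
  assumes "y \<in> X"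
  shows "\<exists>v. (v = y \<or> (y, v) \<in> R) \<and> cty v = cty y \<and> good True v"
proof -
  have "finite (cty y)"
    using cty_sub[of y] finite_\<Sigma> finite_subset[of "cty y" "Pow \<Sigma>"] by simp
  from has_sm_above[OF this subset_refl assms]
  obtain v where v: "(y, v) \<in> R" "cty v = cty y" "\<forall>t\<in>cty v. has_sm t (cty v) v" by auto
  have "good True v"
    unfolding good_def
  proof (intro conjI ballI)
    show "v \<in> X" using R_in v(1) by blast
    fix t assume "t \<in> cty v"
    then obtain z where z: "(v, z) \<in> E" "strongly_maximal t (cty v) z"
      using v(3) unfolding has_sm_def by blast
    have "True \<and> holds z a \<or> (\<exists>w. (z, w) \<in> R \<and> holds w a \<and> gone (cty v) w)"
      if a: "Dia a \<in> \<Sigma>" "holds z (Dia a)" for a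
    proof -
      obtain w where w: "(z, w) \<in> R" "holds w a" using a(2) by auto
      \<comment> \<open>A witness that is not gone repeats the type of \<open>z\<close>, so
        \<open>a\<close> holds at \<open>z\<close> already; this is the case that the flag
        \<open>True\<close> of \<open>good\<close> allows for.\<close>
      have "ty w = ty z \<or> gone (cty v) w" using z(2) w(1) unfolding strongly_maximal_def by blast
      then show ?thesis
      proof
        assume eq: "ty w = ty z"
        have "a \<in> ty w" using w(2) \<Sigma>_Dia[OF a(1)] by (simp add: ty_def)
        then show ?thesis unfolding eq by (simp add: ty_def)
      qed (use w in blast)
    qed
    moreover have "ty z = t" using z(2) by (simp add: strongly_maximal_def)
    ultimately show "\<exists>z. (v, z) \<in> E \<and> ty z = t \<and> (\<forall>a. Dia a \<in> \<Sigma> \<longrightarrow> holds z (Dia a) \<longrightarrow>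
        True \<and> holds z a \<or> (\<exists>w. (z, w) \<in> R \<and> holds w a \<and> gone (cty v) w))"
      using z(1) by blast
  qed
  with v(1,2) show ?thesis by blast
qed

end

section \<open>The finite model property\<close>

lemma (in translation) normal_op_closure:
  assumes "f ` Kplus B \<subseteq> closure A" "\<And>a. a \<in> closure A \<Longrightarrow> Neg (D (Neg a)) \<in> closure A"
  shows "normal_op (closure A) D"
proof -
  have ax: "subst s (f u) \<in> closure A" if "u \<in> Kplus B" for u s
    using that assms(1) by (intro closure.subst) blast
  show ?thesis
    unfolding normal_op_def
  proof (intro conjI allI ballI)
    fix a b
    show "Imp (Neg (D (Neg (Imp a b)))) (Imp (Neg (D (Neg a))) (Neg (D (Neg b)))) \<in> closure A"
      using ax[OF Kplus.K, of "\<lambda>n. if n = 0 then a else b"] by simp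
    show "Imp (D a) (Neg (Neg (D (Neg (Neg a))))) \<in> closure A"
      using ax[OF Kplus.dual1, of "\<lambda>_. a"] by simp
    show "Imp (Neg (Neg (D (Neg (Neg a))))) (D a) \<in> closure A"
      using ax[OF Kplus.dual2, of "\<lambda>_. a"] by simp
  qed (rule assms(2))
qed

lemma normal_logic_closure:
  assumes Dia: "in_Dia ` Kplus B \<subseteq> closure A" and Ex: "in_Ex ` Kplus C \<subseteq> closure A"
  shows "normal_logic (closure A)"
proof
  \<comment> \<open>Letting the substitution range over bimodal formulae yields the propositional
    schemes of the whole language from unimodal tautologies.\<close>
  have taut: "subst s (in_Dia u) \<in> closure A" if "utaut u" for u s
    using Dia Kplus.taut[OF that] by (intro closure.subst) blast
  fix a b c
  show "Imp a (Imp b a) \<in> closure A"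
    using taut[of "UImp (UVar 0) (UImp (UVar 1) (UVar 0))" "\<lambda>n. if n = 0 then a else b"]
    by (simp add: utaut_def)
  show "Imp (Imp a (Imp b c)) (Imp (Imp a b) (Imp a c)) \<in> closure A"
    using taut[of "UImp (UImp (UVar 0) (UImp (UVar 1) (UVar 2)))
        (UImp (UImp (UVar 0) (UVar 1)) (UImp (UVar 0) (UVar 2)))"
        "\<lambda>n. if n = 0 then a else if n = 1 then b else c"]
    by (simp add: utaut_def)
  show "Imp (Neg (Neg a)) a \<in> closure A"
    using taut[of "UImp (UNeg (UNeg (UVar 0))) (UVar 0)" "\<lambda>_. a"]
    by (simp add: utaut_def)
  show "Imp a b \<in> closure A \<Longrightarrow> a \<in> closure A \<Longrightarrow> b \<in> closure A"
    by (rule closure.MP)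
  show "normal_op (closure A) Dia"
    by (rule dia.normal_op_closure[OF Dia]) (rule closure.nec_Box)
  show "normal_op (closure A) Ex"
    by (rule ex.normal_op_closure[OF Ex]) (rule closure.nec_All)
qed

lemma MB_contains:
  shows "in_Dia ` L \<subseteq> MB L" "in_Ex ` S5 \<subseteq> MB L"
    "Imp (Ex (Dia (Var 0))) (Dia (Ex (Var 0))) \<in> MB L"
    "Imp (Dia (Ex (Var 0))) (Ex (Dia (Var 0))) \<in> MB L"
  unfolding MB_def fusion_def extend_def Let_def by (auto intro!: closure.base)

section \<open>Canonical frames\<close>

lemma (in tight_model) equiv_E_S5:
  assumes T: "\<And>x b. x \<in> X \<Longrightarrow> sat R E V x (Imp (All b) b)"
    and 4: "\<And>x b. x \<in> X \<Longrightarrow> sat R E V x (Imp (All b) (All (All b)))"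
    and B: "\<And>x b. x \<in> X \<Longrightarrow> sat R E V x (Imp b (All (Ex b)))"
  shows "equiv X E"
proof (rule equivI)
  show "E \<subseteq> X \<times> X"
    by (rule subrelI) (simp add: tight_E del: sat.simps)
  show "refl_on X E"
  proof (rule refl_onI)
    fix x assume x: "x \<in> X"
    have "sat R E V x (All b) \<longrightarrow> sat R E V x b" for b
      using T[OF x, of b] by (rule sat.simps(3)[THEN iffD1])
    then show "(x, x) \<in> E" using x unfolding tight_E by blast
  qed
  show "trans E"
  proof (rule transI)
    fix x y z assume xy: "(x, y) \<in> E" and yz: "(y, z) \<in> E"
    have X: "x \<in> X" "z \<in> X" using xy yz unfolding tight_E by blast+
    have "sat R E V z b" if b: "sat R E V x (All b)" for b
    proof -
      have "sat R E V x (All (All b))" by (rule sat_MP[OF 4[OF X(1)] b])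
      then have "sat R E V y (All b)" using xy unfolding tight_E by blast
      then show ?thesis using yz unfolding tight_E by blast
    qed
    then show "(x, z) \<in> E" using X unfolding tight_E by blast
  qed
  show "sym E"
  proof (rule symI)
    fix x y assume xy: "(x, y) \<in> E"
    have X: "x \<in> X" "y \<in> X" using xy unfolding tight_E by blast+
    have "sat R E V x b" if b: "sat R E V y (All b)" for b
    proof (rule ccontr)
      assume "\<not> sat R E V x b"
      then have "sat R E V x (Neg b)" by simp
      then have "sat R E V x (All (Ex (Neg b)))" by (rule sat_MP[OF B[OF X(1)]])
      then have "sat R E V y (Ex (Neg b))" using xy unfolding tight_E by blast
      then show False using b by simp
    qed
    then show "(y, x) \<in> E" using X unfolding tight_E by blast
  qed
qed

lemma (in tight_model) trans_R_4:
  assumes 4: "\<And>x b. x \<in> X \<Longrightarrow> sat R E V x (Box b) \<Longrightarrow> sat R E V x (Box (Box b))"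
  shows "trans R"
proof (rule transI)
  fix x y z assume xy: "(x, y) \<in> R" and yz: "(y, z) \<in> R"
  have X: "x \<in> X" "z \<in> X" using xy yz unfolding tight_R by blast+
  have "sat R E V z b" if b: "sat R E V x (Box b)" for b
  proof -
    have "sat R E V y (Box b)" using 4[OF X(1) b] xy unfolding tight_R by blast
    then show ?thesis using yz unfolding tight_R by blast
  qed
  then show "(x, z) \<in> R" using X unfolding tight_R by blast
qed

text \<open>Any closure containing some \<open>MB (Kplus B)\<close> is covered, hence both logics.
  Theorems come back with all substitution instances, since the axioms are later applied to formulae
  defining properties of points.\<close>

lemma canonical_MB:
  assumes MB: "MB (Kplus B) \<subseteq> closure A" and "a \<notin> closure A"
  obtains X :: "fm set set" and R E V x
  where "tight_model X R E V" "equiv X E" "x \<in> X" "\<not> sat R E V x a"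
    "\<And>s b x. b \<in> closure A \<Longrightarrow> x \<in> X \<Longrightarrow> sat R E V x (subst s b)"
    "\<And>b x. x \<in> X \<Longrightarrow> sat R E V x (Imp (Ex (Dia b)) (Dia (Ex b)))"
    "\<And>b x. x \<in> X \<Longrightarrow> sat R E V x (Imp (Dia (Ex b)) (Ex (Dia b)))"
proof -
  interpret normal_logic "closure A"
    by (rule normal_logic_closure[OF subset_trans[OF MB_contains(1) MB]
          subset_trans[OF MB_contains(2)[unfolded S5_def Let_def] MB]])
  obtain X :: "fm set set" and R E V x
    where tight: "tight_model X R E V" and x: "x \<in> X" "\<not> sat R E V x a"
      and M: "\<And>b x. b \<in> closure A \<Longrightarrow> x \<in> X \<Longrightarrow> sat R E V x b"
    using canonical_model[OF assms(2)] by metis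
  have inst: "sat R E V x (subst s b)" if "b \<in> closure A" "x \<in> X" for s b x
    using M closure.subst that by blast
  have S5: "sat R E V x (subst s (in_Ex u))" if "u \<in> S5" "x \<in> X" for u s x
    using inst MB_contains(2) MB that by blast
  interpret tight_model X R E V by (rule tight)
  have "equiv X E"
  proof (rule equiv_E_S5)
    fix x b assume "x \<in> X"
    have ax: "u \<in> S5" if "u \<in> {UImp (UBox (UVar 0)) (UVar 0), UImp (UBox (UVar 0)) (UBox (UBox (UVar 0))),
        UImp (UVar 0) (UBox (UDia (UVar 0)))}" for u
      using that unfolding S5_def Let_def by (rule Kplus.ax)
    have "UImp (UBox (UVar 0)) (UVar 0) \<in> S5" by (rule ax) simp
    from S5[OF this \<open>x \<in> X\<close>, of "\<lambda>_. b"] show "sat R E V x (Imp (All b) b)"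
      by (simp only: in_Ex.simps subst.simps)
    have "UImp (UBox (UVar 0)) (UBox (UBox (UVar 0))) \<in> S5" by (rule ax) simp
    from S5[OF this \<open>x \<in> X\<close>, of "\<lambda>_. b"] show "sat R E V x (Imp (All b) (All (All b)))"
      by (simp only: in_Ex.simps subst.simps)
    have "UImp (UVar 0) (UBox (UDia (UVar 0))) \<in> S5" by (rule ax) simp
    from S5[OF this \<open>x \<in> X\<close>, of "\<lambda>_. b"] show "sat R E V x (Imp b (All (Ex b)))"
      by (simp only: in_Ex.simps subst.simps)
  qed
  moreover have "sat R E V x (Imp (Ex (Dia b)) (Dia (Ex b)))" if "x \<in> X" for x b
    using inst[OF subsetD[OF MB MB_contains(3)] that, of "\<lambda>_. b"] by (simp only: subst.simps)
  moreover have "sat R E V x (Imp (Dia (Ex b)) (Ex (Dia b)))" if "x \<in> X" for x b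
    using inst[OF subsetD[OF MB MB_contains(4)] that, of "\<lambda>_. b"] by (simp only: subst.simps)
  ultimately show thesis
    using that[OF tight _ x inst] by blast
qed

lemma comm_model_sub:
  assumes "tight_model X R E V" "trans R" "equiv X E"
    and "\<And>b x. x \<in> X \<Longrightarrow> sat R E V x (Imp (Ex (Dia b)) (Dia (Ex b)))"
    and "\<And>b x. x \<in> X \<Longrightarrow> sat R E V x (Imp (Dia (Ex b)) (Ex (Dia b)))"
  shows "comm_model X R E V (sub a)"
proof
  show "R \<subseteq> X \<times> X"
    by (rule subrelI) (simp add: tight_model.tight_R[OF assms(1)] del: sat.simps)
  show "\<And>x a. x \<in> X \<Longrightarrow> sat R E V x (Ex (Dia a)) \<Longrightarrow> sat R E V x (Dia (Ex a))"
    by (rule sat_MP[OF assms(4)])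
  show "\<And>x a. x \<in> X \<Longrightarrow> sat R E V x (Dia (Ex a)) \<Longrightarrow> sat R E V x (Ex (Dia a))"
    by (rule sat_MP[OF assms(5)])
qed (use assms(2,3) finite_sub sub_closed in blast)+

lemma MGLB_eq: "MGLB = closure (fusion GL S5 \<union> {Imp (Ex (Dia (Var 0))) (Dia (Ex (Var 0))),
    Imp (Dia (Ex (Var 0))) (Ex (Dia (Var 0)))})"
  by (simp add: MGLB_def MB_def extend_def Let_def)

theorem fmp_MGLB: "fmp MGLB"
proof (rule fmpI)
  fix a assume "a \<notin> MGLB"
  let ?GL = "UImp (UBox (UImp (UBox (UVar 0)) (UVar 0))) (UBox (UVar 0))"
  have "MB (Kplus {?GL}) \<subseteq> MGLB" by (simp add: MGLB_def GL_def Let_def)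
  then obtain X :: "fm set set" and R E V x
    where tight: "tight_model X R E V" and E: "equiv X E" and x: "x \<in> X" "\<not> sat R E V x a"
      and inst: "\<And>s b x. b \<in> MGLB \<Longrightarrow> x \<in> X \<Longrightarrow> sat R E V x (subst s b)"
      and comm: "\<And>b x. x \<in> X \<Longrightarrow> sat R E V x (Imp (Ex (Dia b)) (Dia (Ex b)))"
        "\<And>b x. x \<in> X \<Longrightarrow> sat R E V x (Imp (Dia (Ex b)) (Ex (Dia b)))"
    using canonical_MB[OF _ \<open>a \<notin> MGLB\<close>[unfolded MGLB_eq]] unfolding MGLB_eq by metis
  interpret tight_model X R E V by (rule tight)
  have "?GL \<in> GL" unfolding GL_def Let_def by (rule Kplus.ax) simp
  then have "in_Dia ?GL \<in> MGLB" unfolding MGLB_def by (intro subsetD[OF MB_contains(1)] imageI)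
  from inst[OF this, of _ "\<lambda>_. b" for b]
  have GL: "sat R E V x (Imp (Box (Imp (Box b) b)) (Box b))" if "x \<in> X" for x b
    using that by (simp only: in_Dia.simps subst.simps)
  have "trans R"
  proof (rule trans_R_4)
    fix x b assume x: "x \<in> X" and b: "sat R E V x (Box b)"
    \<comment> \<open>The conjunction of \<open>b\<close> and \<open>Box b\<close>, the usual
      instance for deriving transitivity from Loeb's axiom.\<close>
    let ?c = "Neg (Imp b (Neg (Box b)))"
    have "sat R E V x (Box (Imp (Box ?c) ?c))" using b by simp
    then have "sat R E V x (Box ?c)" by (rule sat_MP[OF GL[OF x]])
    then show "sat R E V x (Box (Box b))" by simp
  qed
  interpret comm_model X R E V "sub a"
    using comm_model_sub[OF tight \<open>trans R\<close> E comm] .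
  have "refuted (points False) (below_r False) (same False) a"
    using refuted_quotient[OF good_above_GL[OF GL] _ sub_refl x] by blast
  moreover have "below_r False = below False" by (simp add: below_r_def)
  ultimately show "\<exists>(X :: point set) R E. finite X \<and> logic_frame MGLB X R E \<and> refuted X R E a"
    using strict_frame.logic_frame_MGLB[OF strict_frame_below] strict_frame.finite_X[OF strict_frame_below]
    by metis
qed

abbreviation Cas :: fm where
  "Cas \<equiv> Imp (Box (All (Imp (Box (Imp (Box (Var 0)) (Box (All (Var 0))))) (Box (All (Var 0)))))) (Box (All (Var 0)))"

lemma MplusGrzB_eq: "MplusGrzB = closure (MGrzB \<union> {Cas})"
  by (simp add: MplusGrzB_def extend_def Let_def)

theorem fmp_MplusGrzB: "fmp MplusGrzB"
proof (rule fmpI)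
  fix a assume "a \<notin> MplusGrzB"
  let ?Grz = "UImp (UBox (UImp (UBox (UImp (UVar 0) (UBox (UVar 0)))) (UVar 0))) (UVar 0)"
  have sub: "MGrzB \<subseteq> MplusGrzB" unfolding MplusGrzB_eq by (auto intro: closure.base)
  then have "MB (Kplus {?Grz}) \<subseteq> MplusGrzB" by (simp add: MGrzB_def Grz_def Let_def)
  then obtain X :: "fm set set" and R E V x
    where tight: "tight_model X R E V" and E: "equiv X E" and x: "x \<in> X" "\<not> sat R E V x a"
      and inst: "\<And>s b x. b \<in> MplusGrzB \<Longrightarrow> x \<in> X \<Longrightarrow> sat R E V x (subst s b)"
      and comm: "\<And>b x. x \<in> X \<Longrightarrow> sat R E V x (Imp (Ex (Dia b)) (Dia (Ex b)))"
        "\<And>b x. x \<in> X \<Longrightarrow> sat R E V x (Imp (Dia (Ex b)) (Ex (Dia b)))"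
    using canonical_MB[OF _ \<open>a \<notin> MplusGrzB\<close>[unfolded MplusGrzB_eq]] unfolding MplusGrzB_eq by metis
  interpret tight_model X R E V by (rule tight)
  have "?Grz \<in> Grz" unfolding Grz_def Let_def by (rule Kplus.ax) simp
  then have "in_Dia ?Grz \<in> MGrzB" unfolding MGrzB_def by (intro subsetD[OF MB_contains(1)] imageI)
  then have "in_Dia ?Grz \<in> MplusGrzB" using sub by blast
  from inst[OF this, of _ "\<lambda>_. b" for b]
  have Grz: "sat R E V x (Imp (Box (Imp (Box (Imp b (Box b))) b)) b)" if "x \<in> X" for x b
    using that by (simp only: in_Dia.simps subst.simps)
  have "Cas \<in> MplusGrzB" unfolding MplusGrzB_eq by (auto intro: closure.base)
  from inst[OF this, of _ "\<lambda>_. b" for b]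
  have Casari: "sat R E V x (Imp (Box (All (Imp (Box (Imp (Box b) (Box (All b)))) (Box (All b))))) (Box (All b)))"
    if "x \<in> X" for x b
    using that by (simp only: subst.simps)
  have T: "sat R E V x b" if x: "x \<in> X" and b: "sat R E V x (Box b)" for x b
  proof -
    have "sat R E V x (Box (Imp (Box (Imp b (Box b))) b))" using b by simp
    then show ?thesis by (rule sat_MP[OF Grz[OF x]])
  qed
  have refl: "(x, x) \<in> R" if "x \<in> X" for x
    unfolding tight_R using T[OF that] that by blast
  have "trans R"
  proof (rule trans_R_4)
    fix x b assume x: "x \<in> X" and b: "sat R E V x (Box b)"
    text \<open>Instantiating Grz with \<open>c = b \<and> (\<box>b \<longrightarrow> \<box>\<box>b)\<close> makes its premise follow from \<open>\<box>b\<close>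
      in \<open>K\<close> alone.\<close>
    let ?c = "Neg (Imp b (Neg (Imp (Box b) (Box (Box b)))))"
    have c: "sat R E V z ?c \<longleftrightarrow> sat R E V z b \<and> (sat R E V z (Box b) \<longrightarrow> sat R E V z (Box (Box b)))" for z
      by (simp only: sat.simps) blast
    have box: "sat R E V z (Box d) \<longleftrightarrow> (\<forall>y. (z, y) \<in> R \<longrightarrow> sat R E V y d)" for z d
      by simp
    have "sat R E V y ?c" if y: "(x, y) \<in> R" and cc: "sat R E V y (Box (Imp ?c (Box ?c)))" for y
    proof -
      have yb: "sat R E V y b" using b y unfolding box by blast
      \<comment> \<open>If \<open>Box b\<close> failed at \<open>z\<close>, the implication inside
        \<open>?c\<close> would hold there vacuously, and so would \<open>?c\<close>; its
        persistence then gives \<open>Box b\<close> at \<open>z\<close>.\<close>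
      have "sat R E V z (Box b)" if yb': "sat R E V y (Box b)" and yz: "(y, z) \<in> R" for z
      proof (rule ccontr)
        assume no: "\<not> sat R E V z (Box b)"
        then have "sat R E V z ?c" using yb' yz unfolding c box[of y] by blast
        have "sat R E V z (Imp ?c (Box ?c))" using cc yz unfolding box by blast
        then have "sat R E V z (Box ?c)" by (rule sat_MP) fact
        then have "sat R E V z (Box b)" unfolding box c by blast
        then show False using no by blast
      qed
      then have "sat R E V y (Box b) \<longrightarrow> sat R E V y (Box (Box b))" unfolding box[of y "Box b"] by blast
      with yb show ?thesis unfolding c by blast
    qed
    then have "sat R E V x (Box (Imp (Box (Imp ?c (Box ?c))) ?c))"
      unfolding box[of x] sat.simps(3)[of R E V _ "Box (Imp ?c (Box ?c))"] by blast
    then have "sat R E V x ?c" by (rule sat_MP[OF Grz[OF x]])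
    then show "sat R E V x (Box (Box b))" using b unfolding c by blast
  qed
  interpret comm_model X R E V "sub a"
    using comm_model_sub[OF tight \<open>trans R\<close> E comm] .
  interpret grz_model X R E V "sub a"
    by unfold_locales (fact refl Grz Casari)+
  have "refuted (points True) (below_r True) (same True) a"
    using refuted_quotient[OF good_above refl sub_refl x] by blast
  moreover have "below_r True = below True \<union> Id_on (points True)" by (simp add: below_r_def)
  ultimately show "\<exists>(X :: point set) R E. finite X \<and> logic_frame MplusGrzB X R E \<and> refuted X R E a"
    using strict_frame.logic_frame_MplusGrzB[OF strict_frame_below] strict_frame.finite_X[OF strict_frame_below]
    by metis
qed

theorem theorem5p2:
  shows "fmp MplusGrzB \<and> fmp MGLB"
  using fmp_MplusGrzB fmp_MGLB by blast

end
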